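(* Let $K/\mathbb{Q}$ be a number field of degree $n$. Let $\mathfrak{p}$ be a nonzero prime ideal of $\mathcal{O}_K$ lying over the rational prime $p$. Let $T \neq \{\mathfrak{p}\}$ be a nonempty set of nonzero prime ideals of $\mathcal{O}_K$ such that some prime ideal in $T$ does not lie over $p$. Then the arithmetic subderivative $D_{K,T}: K \to K$ is $\mathfrak{p}$-adically discontinuous at every nonzero $x \in K$.
   Context: For a nonzero prime ideal $\mathfrak{q}$ of the ring of integers of a number field lying over the rational prime $q$, $\nu_{\mathfrak{q}}$ denotes the associated discrete valuation normalized to extend $\nu_q$, and for a finite Galois extension $L/\mathbb{Q}$, $g(q,L)$ is the number of prime ideals of $\mathcal{O}_L$ over $q$. For $L/\mathbb{Q}$ finite Galois and a set $T'$ of nonzero prime ideals of $\mathcal{O}_L$, $D_{L,T'}(0)=0$ and $D_{L,T'}(x) := x\sum_{\mathfrak{Q}\in T'} \frac{\nu_{\mathfrak{Q}}(x)}{q\,g(q,L)}$ for $x\ne 0$ ($q$ the prime below $\mathfrak{Q}$). For a number field $K$ and a set $T$ of prime ideals of $\mathcal{O}_K$, choose a finite extension $L/K$ with $L/\mathbb{Q}$ Galois, let $T_{L/K}$ be the prime ideals of $\mathcal{O}_L$ lying over elements of $T$, and define $D_{K,T}(x) := D_{L,T_{L/K}}(x)$ (independent of $L$). The $\mathfrak{p}$-adic topology is given by $|x|_{\nu_{\mathfrak{p}}} = c^{\nu_{\mathfrak{p}}(x)}$, $0<c<1$ fixed. *)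

theory Defs
  imports Complex_Main "HOL-Algebra.Ideal_Product" "HOL-Algebra.Algebraic_Closure_Type"
begin

text \<open>
  Number fields are subfields, of finite degree over \<open>\<rat>\<close>, of an arbitrary algebraically closed
  field \<open>'a\<close> of characteristic 0. Every number field embeds into such a field (e.g. into its
  algebraic closure), and all its finite extensions can be taken inside \<open>'a\<close>.
\<close>

abbreviation ambient :: "'a :: field_char_0 ring"
  where "ambient \<equiv> ring_of_type_algebra"

definition has_degree :: "'a :: field_char_0 set \<Rightarrow> nat \<Rightarrow> bool"
  where "has_degree K n \<longleftrightarrow> ring.dimension ambient n \<rat> K"

definition number_field :: "'a :: field_char_0 set \<Rightarrow> bool"
  where "number_field K \<longleftrightarrow> subfield K ambient \<and> (\<exists>n. has_degree K n)"

definition ring_of_integers :: "'a :: field_char_0 set \<Rightarrow> 'a ring" (\<open>\<O>\<close>)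
  where "\<O> K = ambient \<lparr> carrier := {x \<in> K. algebraic_int x} \<rparr>"

definition nonzero_primes :: "'a :: field_char_0 set \<Rightarrow> 'a set set"
  where "nonzero_primes K = {P. primeideal P (\<O> K) \<and> P \<noteq> {0}}"

text \<open>\<open>P \<inter> \<int> = q\<int>\<close>\<close>

definition lies_over :: "'a :: field_char_0 set \<Rightarrow> nat \<Rightarrow> bool"
  where "lies_over P q \<longleftrightarrow>
    Factorial_Ring.prime q \<and> (\<forall>m::int. of_int m \<in> P \<longleftrightarrow> int q dvd m)"

definition prime_below :: "'a :: field_char_0 set \<Rightarrow> nat"
  where "prime_below P = (THE q. lies_over P q)"

text \<open>
  The exponent of \<open>P\<close> in the factorisation of the ideal generated by \<open>a\<close> is the largest \<open>k\<close> with
  \<open>a \<in> P\<^sup>k\<close>; it is extended from the nonzero elements of \<open>\<O> K\<close> to those of its fraction field \<open>K\<close>.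
  The value at 0 (mathematically \<open>\<infinity>\<close>) is junk and never used.
\<close>

definition ord_integer :: "'a :: field_char_0 set \<Rightarrow> 'a set \<Rightarrow> 'a \<Rightarrow> nat"
  where "ord_integer K P a = (GREATEST k::nat. a \<in> P [^]\<^bsub>ideals_set (\<O> K)\<^esub> k)"

definition ord_at :: "'a :: field_char_0 set \<Rightarrow> 'a set \<Rightarrow> 'a \<Rightarrow> int"
  where "ord_at K P x = (THE m. \<exists>a\<in>carrier (\<O> K) - {0}. \<exists>b\<in>carrier (\<O> K) - {0}.
           x = a / b \<and> m = int (ord_integer K P a) - int (ord_integer K P b))"

text \<open>
  Division by the ramification index \<open>ord_at K P q\<close> normalises the valuation so that it extends the
  \<open>q\<close>-adic valuation of \<open>\<rat>\<close>.
\<close>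

definition valuation :: "'a :: field_char_0 set \<Rightarrow> 'a set \<Rightarrow> 'a \<Rightarrow> rat" (\<open>\<nu>\<close>)
  where "\<nu> K P x = of_int (ord_at K P x) / of_int (ord_at K P (of_nat (prime_below P)))"

definition primes_over_count :: "nat \<Rightarrow> 'a :: field_char_0 set \<Rightarrow> nat"
  where "primes_over_count q L = card {Q \<in> nonzero_primes L. lies_over Q q}"

text \<open>
  Normal and separable: an irreducible rational polynomial with a root in \<open>L\<close> is a product of
  pairwise distinct linear factors over \<open>L\<close>.
\<close>

definition finite_galois :: "'a :: field_char_0 set \<Rightarrow> bool"
  where "finite_galois L \<longleftrightarrow> number_field L \<and>
    (\<forall>f :: rat Polynomial.poly.
       Factorial_Ring.irreducible f \<and> (\<exists>x\<in>L. Polynomial.poly (map_poly of_rat f) x = 0) \<longrightarrow>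
       (\<exists>S. finite S \<and> S \<subseteq> L \<and>
          map_poly of_rat f =
            Polynomial.smult (of_rat (Polynomial.lead_coeff f)) (\<Prod>a\<in>S. [:- a, 1:])))"

text \<open>
  \<open>T\<close> may be infinite, while only finitely many summands are nonzero for a given \<open>x \<noteq> 0\<close>. As
  \<^const>\<open>sum\<close> is 0 on infinite index sets, the sum is restricted to its support.
\<close>

definition subderivative_galois ::
    "'a :: field_char_0 set \<Rightarrow> 'a set set \<Rightarrow> 'a \<Rightarrow> 'a"
  where "subderivative_galois L T x =
    (if x = 0 then 0
     else x * of_rat (\<Sum>Q | Q \<in> T \<and> \<nu> L Q x \<noteq> 0.
            \<nu> L Q x / (of_nat (prime_below Q) * of_nat (primes_over_count (prime_below Q) L))))"

definition primes_above ::
    "'a :: field_char_0 set \<Rightarrow> 'a set \<Rightarrow> 'a set set \<Rightarrow> 'a set set"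
  where "primes_above L K T = {Q \<in> nonzero_primes L. Q \<inter> carrier (\<O> K) \<in> T}"

definition subderivative ::
    "'a :: {alg_closed_field, field_char_0} set \<Rightarrow> 'a set set \<Rightarrow> 'a \<Rightarrow> 'a"
  where "subderivative K T =
    (let L = (SOME L. finite_galois L \<and> K \<subseteq> L)
     in subderivative_galois L (primes_above L K T))"

definition padic_abs ::
    "real \<Rightarrow> 'a :: field_char_0 set \<Rightarrow> 'a set \<Rightarrow> 'a \<Rightarrow> real"
  where "padic_abs c K P x = (if x = 0 then 0 else c powr of_rat (\<nu> K P x))"

definition padic_continuous_at ::
    "real \<Rightarrow> 'a :: field_char_0 set \<Rightarrow> 'a set \<Rightarrow> ('a \<Rightarrow> 'a) \<Rightarrow> 'a \<Rightarrow> bool"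
  where "padic_continuous_at c K P f x \<longleftrightarrow>
    (\<forall>\<epsilon>>0. \<exists>\<delta>>0. \<forall>y\<in>K. padic_abs c K P (y - x) < \<delta> \<longrightarrow> padic_abs c K P (f y - f x) < \<epsilon>)"

text \<open>The arithmetic subderivative is a map \<open>K \<rightarrow> K\<close>.\<close>

lemma subderivative_in_field:
  fixes K :: "'a :: {alg_closed_field, field_char_0} set"
  assumes "number_field K" and "x \<in> K"
  shows "subderivative K T x \<in> K"
proof -
  let ?R = "ambient :: 'a ring"
  have K: "subfield K ?R"
    using assms(1) by (simp add: number_field_def)
  interpret R: field ?R by (rule field_from_type_algebra)
  have sub: "subring K ?R"
    using K by (simp add: subfield_def subdomain_def subcring_def)
  have zero: "0 \<in> K" and one: "1 \<in> K"
    and mult: "\<And>a b. a \<in> K \<Longrightarrow> b \<in> K \<Longrightarrow> a * b \<in> K"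
    and add: "\<And>a b. a \<in> K \<Longrightarrow> b \<in> K \<Longrightarrow> a + b \<in> K"
    using subringE(2,3,6,7)[OF sub] by (auto simp: ring_of_type_algebra_def)
  have minus: "- a \<in> K" if "a \<in> K" for a
  proof -
    have "\<ominus>\<^bsub>?R\<^esub> a \<in> K"
      using subringE(5)[OF sub that] .
    moreover have "a + \<ominus>\<^bsub>?R\<^esub> a = 0"
      using R.r_neg[of a] by (simp add: ring_of_type_algebra_def)
    ultimately show ?thesis
      by (metis neg_eq_iff_add_eq_0 add.inverse_unique)
  qed
  have inverse: "inverse a \<in> K" if a: "a \<in> K" "a \<noteq> 0" for a
  proof -
    have "a \<in> Units (?R \<lparr> carrier := K \<rparr>)"
      using subfield.subfield_Units[OF K] a by (simp add: ring_of_type_algebra_def)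
    then obtain b where "b \<in> K" "a * b = 1"
      by (auto simp: Units_def ring_of_type_algebra_def)
    then show ?thesis
      using inverse_unique by metis
  qed
  have nat: "of_nat m \<in> K" for m
    by (induction m) (use zero one add in auto)
  have int: "of_int m \<in> K" for m
    by (cases m) (use nat minus in \<open>auto simp del: of_nat_Suc\<close>)
  have rat: "of_rat r \<in> K" for r
  proof (cases r)
    case (Fract a b)
    then have "(of_rat r :: 'a) = of_int a * inverse (of_int b)"
      by (simp add: of_rat_rat divide_inverse)
    then show ?thesis
      using mult[OF int inverse[OF int]] Fract by simp
  qed
  show ?thesis
    using assms(2) zero mult rat by (auto simp: subderivative_def subderivative_galois_def Let_def)
qed

end

theory Submission
  imports Defs "Jordan_Normal_Form.Char_Poly" "HOL-Number_Theory.Number_Theory"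
begin

text \<open>
  The logarithmic derivative \<open>ld x = D x / x\<close> is additive, and for \<open>y = x u\<close> with rational \<open>u\<close> one has
  \<open>D y - D x = x ((u - 1) (ld x + ld u) + ld u)\<close>. It therefore suffices to find rational \<open>u\<close>
  arbitrarily close to 1 in the \<open>p\<close>-adic topology with \<open>ld u\<close> equal to a fixed nonzero \<open>B\<close>. Let \<open>q \<noteq> p\<close> lie
  below a member of \<open>T\<close>, so \<open>ld q > 0\<close>, and let \<open>q'\<close> be another prime. As \<open>ld\<close> is rational on both, some
  \<open>a / b\<close> with \<open>a\<close> a power of \<open>q'\<close> and \<open>b\<close> a power of \<open>q\<close> satisfies \<open>ld (a / b) = 0\<close> and \<open>a \<noteq> b\<close>.
  Its powers are dense in a neighbourhood of 1 in the \<open>p\<close>-adic units, so they approximate a power \<open>v\<close> of \<open>q\<close>;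
  take \<open>u = v (b / a)\<^sup>n\<close>, for which \<open>ld u = ld v\<close>.

  The valuations are controlled without integral bases: \<open>\<O>/d\<O>\<close> is finite since elements independent
  modulo \<open>p\<close> are linearly independent over \<open>\<rat>\<close>, and for a prime \<open>P\<close> some \<open>g \<notin> \<O>\<close> with \<open>g P \<subseteq> \<O>\<close> gives
  \<open>a \<in> P\<^sup>k \<longleftrightarrow> g\<^sup>k a \<in> \<O>\<close>.
\<close>

section \<open>Algebraic integers\<close>

text \<open>The obvious candidates for \<open>u\<close> are the powers of q with exponent totient
  (p^N). They tend to 1, but their logarithmic derivative totient (p^N) * ld q tends to 0 p-adically
  as well, so D y - D x would shrink along with them. The second prime repairs this: multiplication
  by powers of b / a moves \<open>u\<close> towards 1 while \<open>ld u\<close> stays put, so the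
  contribution x B keeps its p-adic size and the contribution with the factor u - 1 dies out.
  Rational \<open>u\<close> also reconciles two fields. The logarithmic derivative is computed with
  primes of a Galois field L containing K, the topology with the prime P of K; on rational numbers
  all the valuations involved are ordinary multiplicities of primes in integers. The finiteness of
  residue rings carries most of the ideal theory here: inverses modulo P, complete integral
  closedness, finitely many primes containing an element, and the existence of maximal ideals all
  come from counting representatives.\<close>

definition int_scale :: "int \<Rightarrow> 'a \<Rightarrow> 'a::field_char_0"
  where "int_scale c x = of_int c * x"

interpretation int_span: Modules.module int_scale
  by unfold_locales (auto simp: int_scale_def algebra_simps)

text \<open>The determinant trick: multiplication by z acts on B through an integer matrix, z is an
  eigenvalue with eigenvector the list of elements of B (nonzero because of b), and the
  characteristic polynomial is monic and integral.\<close>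

lemma algebraic_int_if_stable_span:
  fixes z :: "'a::field_char_0"
  assumes B: "finite B" and b: "b \<in> B" "b \<noteq> 0"
    and stable: "\<And>b. b \<in> B \<Longrightarrow> z * b \<in> int_span.span B"
  shows "algebraic_int z"
proof -
  have "\<exists>c::'a \<Rightarrow> int. z * b = (\<Sum>b'\<in>B. of_int (c b') * b')" if "b \<in> B" for b
    using stable[OF that] unfolding int_span.span_finite[OF B] by (auto simp: int_scale_def)
  then obtain c :: "'a \<Rightarrow> 'a \<Rightarrow> int"
    where c: "\<And>b. b \<in> B \<Longrightarrow> z * b = (\<Sum>b'\<in>B. of_int (c b b') * b')"
    by metis
  obtain h where h: "bij_betw h {0..<card B} B"
    using ex_bij_betw_nat_finite[OF B] by blast
  define n where "n = card B"
  define A where "A = mat n n (\<lambda>(i, j). c (h i) (h j))"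
  define A' where "A' = map_mat (of_int :: int \<Rightarrow> 'a) A"
  define v where "v = vec n h"
  have A: "A \<in> carrier_mat n n" and A': "A' \<in> carrier_mat n n" and v: "v \<in> carrier_vec n"
    by (auto simp: A_def A'_def v_def)
  obtain i where i: "i < n" "h i = b"
    using h b(1) unfolding bij_betw_def n_def by (metis atLeastLessThan_iff imageE)
  have "v \<noteq> 0\<^sub>v n"
    using i b(2) by (auto simp: v_def vec_eq_iff)
  moreover have "A' *\<^sub>v v = z \<cdot>\<^sub>v v"
  proof (rule eq_vecI)
    fix i assume "i < dim_vec (z \<cdot>\<^sub>v v)"
    then have i: "i < n" by (simp add: v_def)
    then have "h i \<in> B"
      using h unfolding bij_betw_def n_def by auto
    then have "z * h i = (\<Sum>b'\<in>B. of_int (c (h i) b') * b')"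
      by (rule c)
    also have "\<dots> = (\<Sum>j\<in>{0..<n}. of_int (c (h i) (h j)) * h j)"
      unfolding n_def by (rule sum.reindex_bij_betw[OF h, symmetric])
    finally show "(A' *\<^sub>v v) $ i = (z \<cdot>\<^sub>v v) $ i"
      using i by (simp add: A'_def A_def v_def scalar_prod_def)
  qed (simp add: A'_def A_def v_def)
  ultimately have "eigenvector A' v z"
    using A' v unfolding eigenvector_def by auto
  then have "poly (char_poly A') z = 0"
    using eigenvalue_root_char_poly[OF A'] unfolding eigenvalue_def by blast
  moreover interpret of_int_hom: comm_ring_hom "of_int :: int \<Rightarrow> 'a"
    by unfold_locales auto
  have "char_poly A' = map_poly of_int (char_poly A)"
    unfolding A'_def by (rule of_int_hom.char_poly_hom[OF A])
  moreover have "Polynomial.lead_coeff (char_poly A) = 1"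
    using degree_monic_char_poly[OF A] by auto
  ultimately show ?thesis
    unfolding algebraic_int_altdef_ipoly by auto
qed

text \<open>The integral equation as a rule for lowering exponents. The bound \<open>m > 0\<close>
  ensures that 1 is among the lower powers.\<close>

lemma algebraic_int_power_in_span:
  fixes x :: "'a::field_char_0"
  assumes "algebraic_int x"
  obtains m where "m > 0" "x ^ m \<in> int_span.span ((\<lambda>i. x ^ i) ` {..<m})"
proof -
  obtain p where p: "poly (map_poly of_int p) x = 0" "Polynomial.lead_coeff p = 1"
    using assms unfolding algebraic_int_altdef_ipoly by auto
  define m where "m = Polynomial.degree p"
  have deg: "Polynomial.degree (map_poly of_int p :: 'a Polynomial.poly) = m"
    unfolding m_def by (rule degree_map_poly) auto
  have "m > 0"
  proof (rule ccontr)
    assume "\<not> m > 0"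
    then obtain a where "p = [:a:]"
      unfolding m_def by (auto elim: degree_eq_zeroE)
    then show False
      using p by auto
  qed
  have "0 = (\<Sum>i\<le>m. of_int (Polynomial.coeff p i) * x ^ i)"
    using p(1) unfolding poly_altdef deg by (simp add: coeff_map_poly)
  also have "\<dots> = (\<Sum>i<m. of_int (Polynomial.coeff p i) * x ^ i) + x ^ m"
    using p(2) by (simp add: lessThan_Suc_atMost[symmetric] m_def)
  finally have "x ^ m = (\<Sum>i<m. int_scale (- Polynomial.coeff p i) (x ^ i))"
    by (simp add: int_scale_def sum_negf eq_neg_iff_add_eq_0 add.commute)
  also have "\<dots> \<in> int_span.span ((\<lambda>i. x ^ i) ` {..<m})"
    by (intro int_span.span_sum int_span.span_scale int_span.span_base) auto
  finally show ?thesis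
    using that \<open>m > 0\<close> by blast
qed

lemma int_span_mult_closed:
  assumes "\<And>b. b \<in> B \<Longrightarrow> z * b \<in> int_span.span C" "w \<in> int_span.span B"
  shows "z * w \<in> int_span.span C"
  using assms(2)
proof (induction rule: int_span.span_induct_alt)
  case base
  then show ?case by (simp add: int_span.span_zero)
next
  case (step c b w)
  have "z * (int_scale c b + w) = int_scale c (z * b) + z * w"
    by (simp add: int_scale_def algebra_simps)
  then show ?case
    using assms(1) step int_span.span_add int_span.span_scale by metis
qed

text \<open>The finitely many products x^i y^j with exponents below the two degrees span a set
  stable under both x and y, hence under x + y and x * y.\<close>

lemma
  fixes x y :: "'a::field_char_0"
  assumes x: "algebraic_int x" and y: "algebraic_int y"
  shows algebraic_int_plus: "algebraic_int (x + y)"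
    and algebraic_int_times: "algebraic_int (x * y)"
proof -
  obtain m where m: "m > 0" "x ^ m \<in> int_span.span ((\<lambda>i. x ^ i) ` {..<m})"
    using algebraic_int_power_in_span[OF x] .
  obtain n where n: "n > 0" "y ^ n \<in> int_span.span ((\<lambda>i. y ^ i) ` {..<n})"
    using algebraic_int_power_in_span[OF y] .
  define B where "B = (\<lambda>(i, j). x ^ i * y ^ j) ` ({..<m} \<times> {..<n})"
  have B: "finite B" "1 \<in> B"
    using m(1) n(1) by (auto simp: B_def intro!: image_eqI[of _ _ "(0, 0)"])
  have BI: "x ^ i * y ^ j \<in> B" if "i < m" "j < n" for i j
    using that by (auto simp: B_def intro!: image_eqI[of _ _ "(i, j)"])
  have sx: "x * b \<in> int_span.span B" if b: "b \<in> B" for b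
  proof -
    obtain i j where ij: "b = x ^ i * y ^ j" "i < m" "j < n"
      using b by (auto simp: B_def)
    show ?thesis
    proof (cases "Suc i < m")
      case True
      then show ?thesis
        using BI[OF True ij(3)] ij(1) by (auto intro!: int_span.span_base simp: mult_ac)
    next
      case False
      \<comment> \<open>Here i = m - 1, so the product contains x^m, which the integral equation
        rewrites by lower powers.\<close>
      then have "x * b = y ^ j * x ^ m"
        using ij by (metis Suc_lessI mult.assoc mult.commute power_Suc)
      also have "\<dots> \<in> int_span.span B"
        by (rule int_span_mult_closed[OF _ m(2)])
           (use BI ij(3) in \<open>auto intro!: int_span.span_base simp: mult.commute\<close>)
      finally show ?thesis .
    qed
  qed
  have sy: "y * b \<in> int_span.span B" if b: "b \<in> B" for b
  proof -
    obtain i j where ij: "b = x ^ i * y ^ j" "i < m" "j < n"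
      using b by (auto simp: B_def)
    show ?thesis
    proof (cases "Suc j < n")
      case True
      then show ?thesis
        using BI[OF ij(2) True] ij(1) by (auto intro!: int_span.span_base simp: mult_ac)
    next
      case False
      then have "y * b = x ^ i * y ^ n"
        using ij by (metis Suc_lessI mult.left_commute power_Suc)
      also have "\<dots> \<in> int_span.span B"
        by (rule int_span_mult_closed[OF _ n(2)])
           (use BI ij(2) in \<open>auto intro!: int_span.span_base simp: mult.commute\<close>)
      finally show ?thesis .
    qed
  qed
  show "algebraic_int (x + y)"
    by (rule algebraic_int_if_stable_span[OF B]) 
       (auto simp: distrib_right intro!: int_span.span_add sx sy)
  show "algebraic_int (x * y)"
    by (rule algebraic_int_if_stable_span[OF B]) 
       (auto simp: mult.assoc intro!: int_span_mult_closed[OF sx] sy)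
qed

lemma algebraic_int_diff:
  fixes x y :: "'a::field_char_0"
  shows "algebraic_int x \<Longrightarrow> algebraic_int y \<Longrightarrow> algebraic_int (x - y)"
  using algebraic_int_plus[of x "- y"] by simp

lemma algebraic_int_power:
  fixes x :: "'a::field_char_0"
  shows "algebraic_int x \<Longrightarrow> algebraic_int (x ^ n)"
  by (induction n) (auto intro: algebraic_int_times)

section \<open>Number fields\<close>

lemma ambient_simps [simp]:
  "carrier ambient = UNIV" "x \<otimes>\<^bsub>ambient\<^esub> y = x * y" "x \<oplus>\<^bsub>ambient\<^esub> y = x + y"
  "\<one>\<^bsub>ambient\<^esub> = 1" "\<zero>\<^bsub>ambient\<^esub> = 0"
  by (simp_all add: ring_of_type_algebra_def)

lemma ambient_a_inv [simp]: "\<ominus>\<^bsub>ambient\<^esub> (x :: 'a :: field_char_0) = - x"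
proof -
  interpret R: field "ambient :: 'a ring" by (rule field_from_type_algebra)
  have "x + \<ominus>\<^bsub>ambient\<^esub> x = 0"
    using R.r_neg[of x] by simp
  then show ?thesis
    by (metis add.inverse_unique)
qed

lemma subfield_ambient_iff:
  "subfield F (ambient :: 'a :: field_char_0 ring) \<longleftrightarrow>
     1 \<in> F \<and> (\<forall>x\<in>F. \<forall>y\<in>F. x + y \<in> F \<and> x * y \<in> F) \<and> (\<forall>x\<in>F. - x \<in> F) \<and>
     (\<forall>x\<in>F - {0}. inverse x \<in> F)"
  (is "_ \<longleftrightarrow> ?rhs")
proof
  interpret R: field "ambient :: 'a ring" by (rule field_from_type_algebra)
  {
    assume F: "subfield F (ambient :: 'a ring)"
    have sub: "subring F ambient"
      using F by (simp add: subfield_def subdomain_def subcring_def)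
    have "inverse a \<in> F" if a: "a \<in> F - {0}" for a
    proof -
      have "a \<in> Units (ambient \<lparr> carrier := F \<rparr>)"
        using subfield.subfield_Units[OF F] a by simp
      then obtain b where "b \<in> F" "a * b = 1"
        by (auto simp: Units_def)
      then show ?thesis
        using inverse_unique by metis
    qed
    then show ?rhs
      using subringE[OF sub] by auto
  }
  assume F: ?rhs
  have "subcring F ambient"
  proof (rule R.subcringI'[OF R.subringI])
    show "\<one>\<^bsub>ambient\<^esub> \<in> F" using F by simp
  qed (use F in auto)
  then show "subfield F (ambient :: 'a ring)"
  proof (rule R.subfieldI)
    show "Units (ambient\<lparr>carrier := F\<rparr>) = F - {\<zero>\<^bsub>ambient\<^esub>}"
    proof
      show "Units (ambient\<lparr>carrier := F\<rparr>) \<subseteq> F - {\<zero>\<^bsub>ambient\<^esub>}"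
        by (auto simp: Units_def)
      show "F - {\<zero>\<^bsub>ambient\<^esub>} \<subseteq> Units (ambient\<lparr>carrier := F\<rparr>)"
      proof
        fix a assume a: "a \<in> F - {\<zero>\<^bsub>ambient\<^esub>}"
        then have "inverse a \<in> F" "inverse a * a = 1" "a * inverse a = 1"
          using F by auto
        then show "a \<in> Units (ambient\<lparr>carrier := F\<rparr>)"
          using a unfolding Units_def ambient_simps by (intro CollectI conjI bexI[of _ "inverse a"]) (simp_all add: ambient_simps)
      qed
    qed
  qed
qed

lemma subfield_Rats: "subfield \<rat> (ambient :: 'a :: field_char_0 ring)"
  by (simp add: subfield_ambient_iff)

lemma subfield_closed:
  fixes F :: "'a :: field_char_0 set"
  assumes F: "subfield F ambient"
  shows "1 \<in> F" "0 \<in> F" "x \<in> F \<Longrightarrow> y \<in> F \<Longrightarrow> x + y \<in> F" "x \<in> F \<Longrightarrow> y \<in> F \<Longrightarrow> x * y \<in> F"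
    "x \<in> F \<Longrightarrow> - x \<in> F" "x \<in> F \<Longrightarrow> y \<in> F \<Longrightarrow> x - y \<in> F" "x \<in> F \<Longrightarrow> inverse x \<in> F"
    "x \<in> F \<Longrightarrow> y \<in> F \<Longrightarrow> x / y \<in> F" "x \<in> F \<Longrightarrow> x ^ k \<in> F"
    "of_nat k \<in> F" "of_int m \<in> F" "of_rat r \<in> F" "(\<And>i. i \<in> I \<Longrightarrow> f i \<in> F) \<Longrightarrow> sum f I \<in> F"
proof -
  have F': "1 \<in> F" "\<And>x y. x \<in> F \<Longrightarrow> y \<in> F \<Longrightarrow> x + y \<in> F" "\<And>x y. x \<in> F \<Longrightarrow> y \<in> F \<Longrightarrow> x * y \<in> F"
    "\<And>x. x \<in> F \<Longrightarrow> - x \<in> F" "\<And>x. x \<in> F \<Longrightarrow> x \<noteq> 0 \<Longrightarrow> inverse x \<in> F"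
    using F unfolding subfield_ambient_iff by auto
  then show "1 \<in> F" "x \<in> F \<Longrightarrow> y \<in> F \<Longrightarrow> x + y \<in> F" "x \<in> F \<Longrightarrow> y \<in> F \<Longrightarrow> x * y \<in> F"
    "x \<in> F \<Longrightarrow> - x \<in> F" 
    by auto
  show zero: "0 \<in> F"
    using F'(2)[OF F'(1) F'(4)[OF F'(1)]] by simp
  show minus: "x \<in> F \<Longrightarrow> y \<in> F \<Longrightarrow> x - y \<in> F"
    using F'(2)[of x "- y"] F'(4)[of y] by simp
  show inv: "x \<in> F \<Longrightarrow> inverse x \<in> F" for x
    using F'(5)[of x] zero by (cases "x = 0") auto
  show divide: "x \<in> F \<Longrightarrow> y \<in> F \<Longrightarrow> x / y \<in> F" for x y
    using F'(3)[OF _ inv, of x y] by (simp add: divide_inverse)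
  show "x \<in> F \<Longrightarrow> x ^ k \<in> F"
    by (induction k) (use F' in auto)
  show nat: "of_nat k \<in> F" for k
    by (induction k) (use zero F' in auto)
  show int: "of_int m \<in> F" for m
    by (cases m) (use nat F' in \<open>auto simp del: of_nat_Suc\<close>)
  show "of_rat r \<in> F"
    using divide[OF int int] by (cases r) (auto simp: of_rat_rat)
  show "(\<And>i. i \<in> I \<Longrightarrow> f i \<in> F) \<Longrightarrow> sum f I \<in> F"
    by (induction I rule: infinite_finite_induct) (use zero F' in auto)
qed

section \<open>Integral linear dependence in a field of finite degree\<close>

lemma Rats_common_denominator:
  fixes r :: "'i \<Rightarrow> 'a :: field_char_0"
  assumes "finite I" "\<And>i. i \<in> I \<Longrightarrow> r i \<in> \<rat>"
  shows "\<exists>d::int. d > 0 \<and> (\<forall>i\<in>I. of_int d * r i \<in> \<int>)"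
  using assms
proof (induction I)
  case empty
  show ?case by (intro exI[of _ 1]) auto
next
  case (insert j I)
  then obtain d :: int where d: "d > 0" "\<forall>i\<in>I. of_int d * r i \<in> \<int>"
    by auto
  obtain a b :: int where ab: "b > 0" "r j = of_int a / of_int b"
    using insert.prems[of j] by (auto elim: Rats_cases')
  have "of_int (b * d) * r i \<in> \<int>" if "i \<in> insert j I" for i
  proof (cases "i = j")
    case True
    then have "of_int (b * d) * r i = of_int (d * a)"
      using ab by simp
    then show ?thesis by (simp del: of_int_mult)
  next
    case False
    then have "of_int b * (of_int d * r i) \<in> \<int>"
      using d(2) that by auto
    then show ?thesis by (simp add: mult.assoc)
  qed
  then show ?case
    using ab(1) d(1) by (intro exI[of _ "b * d"]) auto
qed

lemma combine_ambient:
  "length Ks = length Us \<Longrightarrow>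
     ring.combine (ambient :: 'a :: field_char_0 ring) Ks Us = (\<Sum>i<length Us. Ks ! i * Us ! i)"
proof (induction Ks Us rule: list_induct2)
  interpret R: field "ambient :: 'a ring" by (rule field_from_type_algebra)
  case Nil
  show ?case by simp
next
  interpret R: field "ambient :: 'a ring" by (rule field_from_type_algebra)
  case (Cons k Ks u Us)
  then show ?case
    by (simp add: sum.lessThan_Suc_shift del: sum.lessThan_Suc)
qed

text \<open>In a rational space of dimension n any n + 1 vectors are dependent, and clearing
  denominators makes the relation integral, ready for reduction modulo primes. The family becomes a
  list, so repeated values count as a dependence.\<close>

lemma int_dependent:
  fixes f :: "nat \<Rightarrow> 'a :: field_char_0"
  assumes deg: "has_degree K n" and f: "\<And>i. i \<le> n \<Longrightarrow> f i \<in> K"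
  shows "\<exists>c::nat \<Rightarrow> int. (\<exists>i\<le>n. c i \<noteq> 0) \<and> (\<Sum>i\<le>n. of_int (c i) * f i) = 0"
proof -
  interpret R: field "ambient :: 'a ring" by (rule field_from_type_algebra)
  define Us where "Us = map f [0..<Suc n]"
  have len: "length Us = Suc n" and Us: "set Us \<subseteq> K" "set Us \<subseteq> carrier ambient"
    using f by (auto simp: Us_def simp del: upt_Suc)
  have "R.dependent \<rat> Us"
    using R.independent_length_le_dimension[OF subfield_Rats deg[unfolded has_degree_def] _ Us(1)] len
    by auto
  then obtain Ks where Ks: "length Ks = length Us" "R.combine Ks Us = \<zero>\<^bsub>ambient\<^esub>"
    "set Ks \<subseteq> \<rat>" "set Ks \<noteq> {\<zero>\<^bsub>ambient\<^esub>}"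
    using R.dependent_imp_non_trivial_combine[OF subfield_Rats Us(2)] by blast
  have "\<exists>d::int. d > 0 \<and> (\<forall>i\<in>{..n}. of_int d * Ks ! i \<in> \<int>)"
    using Ks(1,3) len by (intro Rats_common_denominator) (auto simp: subset_iff)
  then obtain d :: int where d: "d > 0" "\<And>i. i \<le> n \<Longrightarrow> of_int d * Ks ! i \<in> \<int>"
    by auto
  have "\<forall>i. \<exists>c::int. i \<le> n \<longrightarrow> of_int d * Ks ! i = of_int c"
    using d(2) by (meson Ints_cases)
  then obtain c :: "nat \<Rightarrow> int" where c: "\<And>i. i \<le> n \<Longrightarrow> of_int d * Ks ! i = of_int (c i)"
    by metis
  have "\<exists>i\<le>n. Ks ! i \<noteq> 0"
  proof (rule ccontr)
    assume "\<not> (\<exists>i\<le>n. Ks ! i \<noteq> 0)"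
    then have "set Ks = {0}"
      using Ks(1) len by (auto simp: set_conv_nth less_Suc_eq_le intro!: exI[of _ 0])
    then show False
      using Ks(4) by simp
  qed
  then obtain i where i: "i \<le> n" "Ks ! i \<noteq> 0" by blast
  have "(\<Sum>i\<le>n. of_int (c i) * f i) = (\<Sum>i<Suc n. of_int d * (Ks ! i * Us ! i))"
    unfolding lessThan_Suc_atMost
    by (intro sum.cong) (auto simp: c[symmetric] Us_def nth_append less_Suc_eq_le simp del: upt_Suc)
  also have "\<dots> = of_int d * R.combine Ks Us"
    using combine_ambient[OF Ks(1)] len by (simp add: sum_distrib_left del: sum.lessThan_Suc)
  also have "\<dots> = 0"
    using Ks(2) by simp
  moreover have "c i \<noteq> 0"
    using c[OF i(1)] i(2) d(1) by auto
  ultimately show ?thesis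
    using i(1) by auto
qed

locale number_field_loc =
  fixes K :: "'a :: field_char_0 set"
  assumes number_field: "number_field K"
begin

abbreviation ints :: "'a set"
  where "ints \<equiv> {x \<in> K. algebraic_int x}"

lemma subfield_K: "subfield K ambient"
  using number_field by (simp add: number_field_def)

lemmas K_closed = subfield_closed[OF subfield_K]

lemma ints_closed:
  "0 \<in> ints" "1 \<in> ints" "x \<in> ints \<Longrightarrow> y \<in> ints \<Longrightarrow> x + y \<in> ints"
  "x \<in> ints \<Longrightarrow> y \<in> ints \<Longrightarrow> x * y \<in> ints" "x \<in> ints \<Longrightarrow> - x \<in> ints"
  "x \<in> ints \<Longrightarrow> y \<in> ints \<Longrightarrow> x - y \<in> ints" "x \<in> ints \<Longrightarrow> x ^ k \<in> ints"
  "of_nat k \<in> ints" "of_int m \<in> ints"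
  using K_closed by (auto intro: algebraic_int_plus algebraic_int_times algebraic_int_diff algebraic_int_power)

lemma ints_sum: "(\<And>i. i \<in> I \<Longrightarrow> f i \<in> ints) \<Longrightarrow> sum f I \<in> ints"
  by (induction I rule: infinite_finite_induct) (use ints_closed in auto)

lemma ints_prod: "(\<And>i. i \<in> I \<Longrightarrow> f i \<in> ints) \<Longrightarrow> prod f I \<in> ints"
  by (induction I rule: infinite_finite_induct) (use ints_closed in auto)

lemma ints_poly: "x \<in> ints \<Longrightarrow> poly (map_poly of_int q) x \<in> ints"
  by (induction q) (use ints_closed in \<open>auto simp: map_poly_pCons\<close>)

section \<open>Polynomial relations over the integers and denominators\<close>

lemma root_of_int_poly:
  assumes "x \<in> K"
  obtains q :: "int Polynomial.poly" where "q \<noteq> 0" "poly (map_poly of_int q) x = 0"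
proof -
  obtain n where n: "has_degree K n"
    using number_field by (auto simp: number_field_def)
  have "\<exists>c::nat \<Rightarrow> int. (\<exists>i\<le>n. c i \<noteq> 0) \<and> (\<Sum>i\<le>n. of_int (c i) * x ^ i) = 0"
    by (rule int_dependent[OF n]) (rule K_closed(9)[OF assms])
  then obtain c :: "nat \<Rightarrow> int" and i
    where c: "i \<le> n" "c i \<noteq> 0" "(\<Sum>i\<le>n. of_int (c i) * x ^ i) = 0"
    by auto
  define q where "q = (\<Sum>i\<le>n. Polynomial.monom (c i) i)"
  have "Polynomial.coeff q i = c i"
    using c(1) by (simp add: q_def coeff_sum)
  then have "q \<noteq> 0" using c(2) by auto
  moreover have "map_poly of_int q = (\<Sum>i\<le>n. Polynomial.monom (of_int (c i) :: 'a) i)"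
    by (intro poly_eqI) (simp add: q_def coeff_sum coeff_map_poly)
  then have "poly (map_poly of_int q) x = 0"
    using c(3) by (simp add: poly_sum poly_monom)
  ultimately show ?thesis
    using that by blast
qed

text \<open>Plays the part of the norm. Cancelling powers of the variable in a relation for a leaves
  a nonzero constant term, which is minus a times an integral element; a sign makes it
  positive.\<close>

lemma int_multiple_of_int:
  assumes "a \<in> ints" "a \<noteq> 0"
  obtains d :: nat and e where "d > 0" "e \<in> ints" "a * e = of_nat d"
proof -
  have *: "\<exists>(d::nat)>0. \<exists>e\<in>ints. a * e = of_nat d"
    if "q \<noteq> 0" "poly (map_poly of_int q) a = 0" for q :: "int Polynomial.poly"
    using that
  proof (induction q)
    case (pCons c q)
    show ?case
    proof (cases "c = 0")
      case True
      then show ?thesis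
        using pCons assms(2) by (auto simp: map_poly_pCons)
    next
      case False
      define e where "e = - of_int (sgn c) * poly (map_poly of_int q) a"
      have "e \<in> ints"
        unfolding e_def using ints_poly[OF assms(1), of q] ints_closed(4)[OF ints_closed(9)[of "- sgn c"]] by simp
      have "of_int c + a * poly (map_poly of_int q) a = 0"
        using pCons.prems by (simp add: map_poly_pCons)
      then have "a * poly (map_poly of_int q) a = - of_int c"
        by (simp add: eq_neg_iff_add_eq_0 add.commute)
      then have "a * e = of_int (sgn c * c)"
        by (metis e_def mult.left_commute mult_minus_left mult_minus_right of_int_mult minus_minus)
      moreover have "sgn c * c = int (nat \<bar>c\<bar>)"
        by (auto simp: sgn_if)
      ultimately have "a * e = of_nat (nat \<bar>c\<bar>)"
        by (metis of_int_of_nat_eq)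
      then show ?thesis
        using False \<open>e \<in> ints\<close> by (intro exI[of _ "nat \<bar>c\<bar>"]) auto
    qed
  qed auto
  obtain q :: "int Polynomial.poly" where "q \<noteq> 0" "poly (map_poly of_int q) a = 0"
    using root_of_int_poly[of a] assms by auto
  then show ?thesis
    using *[of q] that by auto
qed

lemma int_multiple_integral:
  assumes "x \<in> K"
  obtains d :: nat where "d > 0" "of_nat d * x \<in> ints"
proof -
  obtain q :: "int Polynomial.poly" where q: "q \<noteq> 0" "poly (map_poly of_int q) x = 0"
    using root_of_int_poly[of x] assms by auto
  define m where "m = Polynomial.degree q"
  define l where "l = Polynomial.lead_coeff q"
  have l: "l \<noteq> 0" using q(1) by (simp add: l_def)
  have m: "m > 0"
  proof (rule ccontr)
    assume "\<not> m > 0"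
    then obtain a where "q = [:a:]"
      unfolding m_def by (auto elim: degree_eq_zeroE)
    then show False using q by (auto simp: map_poly_pCons)
  qed
  \<comment> \<open>This is l^(m - 1) q(X / l), which is monic and has l x as a root.\<close>
  define r :: "'a Polynomial.poly" where
    "r = Polynomial.monom 1 m + (\<Sum>i<m. Polynomial.monom (of_int (Polynomial.coeff q i * l ^ (m - 1 - i))) i)"
  have cr: "Polynomial.coeff r j = (if j = m then 1 else if j < m then of_int (Polynomial.coeff q j * l ^ (m - 1 - j)) else 0)" for j
    by (auto simp: r_def coeff_sum coeff_monom)
  have deg: "Polynomial.degree r = m"
    by (rule antisym[OF degree_le le_degree]) (auto simp: cr)
  have "algebraic_int (of_int l * x)"
  proof
    show "Polynomial.lead_coeff r = 1" by (simp add: deg cr)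
    show "\<forall>i. Polynomial.coeff r i \<in> \<int>" by (auto simp: cr)
    have "poly r (of_int l * x) = of_int l ^ m * x ^ m + (\<Sum>i<m. of_int (Polynomial.coeff q i * l ^ (m - 1 - i)) * (of_int l * x) ^ i)"
      by (simp add: r_def poly_sum poly_monom power_mult_distrib)
    also have "(\<Sum>i<m. of_int (Polynomial.coeff q i * l ^ (m - 1 - i)) * (of_int l * x) ^ i)
       = (\<Sum>i<m. of_int (l ^ (m - 1)) * (of_int (Polynomial.coeff q i) * x ^ i))"
    proof (intro sum.cong refl)
      fix i assume "i \<in> {..<m}"
      then have "(of_int l :: 'a) ^ (m - 1) = of_int l ^ (m - 1 - i) * of_int l ^ i"
        by (auto simp flip: power_add)
      then show "of_int (Polynomial.coeff q i * l ^ (m - 1 - i)) * (of_int l * x) ^ i = of_int (l ^ (m - 1)) * (of_int (Polynomial.coeff q i) * x ^ i)"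
        by (simp add: power_mult_distrib mult_ac)
    qed
    also have "of_int l ^ m * x ^ m + \<dots> = of_int (l ^ (m - 1)) * (\<Sum>i\<le>m. of_int (Polynomial.coeff q i) * x ^ i)"
    proof -
      have "(of_int l :: 'a) ^ m = of_int l * of_int l ^ (m - 1)"
        using m by (metis power_minus_mult mult.commute)
      moreover have "Polynomial.coeff q m = l"
        by (simp add: l_def m_def)
      ultimately show ?thesis
        by (simp add: lessThan_Suc_atMost[symmetric] distrib_left mult.assoc flip: sum_distrib_left)
    qed
    also have "(\<Sum>i\<le>m. of_int (Polynomial.coeff q i) * x ^ i) = poly (map_poly of_int q) x"
      by (simp add: poly_altdef coeff_map_poly degree_map_poly m_def)
    finally show "poly r (of_int l * x) = 0"
      using q(2) by simp
  qed
  then have "of_int l * x \<in> ints"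
    using K_closed(4)[OF K_closed(11) assms] by simp
  then have "of_int (sgn l) * (of_int l * x) \<in> ints"
    by (rule ints_closed(4)[OF ints_closed(9)])
  moreover have "sgn l * l = int (nat \<bar>l\<bar>)"
    by (auto simp: sgn_if)
  then have "of_int (sgn l) * (of_int l * x) = of_nat (nat \<bar>l\<bar>) * x"
    by (metis mult.assoc of_int_mult of_int_of_nat_eq)
  ultimately have "of_nat (nat \<bar>l\<bar>) * x \<in> ints"
    by simp
  then show ?thesis
    using that[of "nat \<bar>l\<bar>"] l by auto
qed

end

section \<open>Finite quotients of the ring of integers\<close>

context number_field_loc
begin

text \<open>Infinite descent: with more than n elements there is a nontrivial integral relation,
  independence modulo p lets its coefficients be divided by p again and again, and a nonzero integer
  is not divisible by every power of p.\<close>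

lemma indep_mod_prime_bounded:
  fixes x :: "nat \<Rightarrow> 'a"
  assumes n: "has_degree K n" and p: "Factorial_Ring.prime p" and x: "\<And>i. i < m \<Longrightarrow> x i \<in> ints"
    and indep: "\<And>c :: nat \<Rightarrow> int. \<exists>t\<in>ints. (\<Sum>i<m. of_int (c i) * x i) = of_nat p * t \<Longrightarrow>
       \<forall>i<m. int p dvd c i"
  shows "m \<le> n"
proof (rule ccontr)
  assume "\<not> m \<le> n"
  then have "\<exists>c::nat \<Rightarrow> int. (\<exists>i\<le>n. c i \<noteq> 0) \<and> (\<Sum>i\<le>n. of_int (c i) * x i) = 0"
    using x by (intro int_dependent[OF n]) auto
  then obtain c :: "nat \<Rightarrow> int" and j
    where c: "j \<le> n" "c j \<noteq> 0" "(\<Sum>i\<le>n. of_int (c i) * x i) = 0"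
    by auto
  have *: "\<forall>i<m. int p ^ k dvd c i" if "(\<Sum>i<m. of_int (c i) * x i) = 0" for k and c :: "nat \<Rightarrow> int"
    using that
  proof (induction k arbitrary: c)
    case (Suc k)
    have "\<forall>i<m. int p dvd c i"
      using Suc.prems ints_closed(1) by (intro indep) (auto intro!: bexI[of _ 0])
    then have c: "c i = int p * (c i div int p)" if "i < m" for i
      using that by auto
    then have "(\<Sum>i<m. of_int (c i) * x i) = (\<Sum>i<m. of_nat p * (of_int (c i div int p) * x i))"
      by (intro sum.cong) (auto simp: mult.assoc, metis mult.assoc of_int_mult of_int_of_nat_eq)
    then have "of_nat p * (\<Sum>i<m. of_int (c i div int p) * x i) = 0"
      using Suc.prems by (simp add: sum_distrib_left)
    then have "(\<Sum>i<m. of_int (c i div int p) * x i) = 0"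
      using p by (auto simp: prime_gt_0_nat)
    then have "\<forall>i<m. int p ^ k dvd c i div int p"
      by (rule Suc.IH)
    then show ?case
      using c by (metis mult_dvd_mono dvd_refl power_Suc)
  qed auto
  define c' where "c' = (\<lambda>i. if i \<le> n then c i else 0)"
  have "(\<Sum>i<m. of_int (c' i) * x i) = (\<Sum>i\<le>n. of_int (c i) * x i)"
    using \<open>\<not> m \<le> n\<close> by (intro sum.mono_neutral_cong_right) (auto simp: c'_def)
  then have dvd: "int p ^ k dvd c j" for k
  proof -
    have "j < m" using c(1) \<open>\<not> m \<le> n\<close> by simp
    moreover have "(\<Sum>i<m. of_int (c' i) * x i) = 0"
      using \<open>(\<Sum>i<m. of_int (c' i) * x i) = (\<Sum>i\<le>n. of_int (c i) * x i)\<close> c(3) by simp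
    ultimately have "int p ^ k dvd c' j"
      using *[of c' k] by blast
    then show ?thesis
      using c(1) by (simp add: c'_def)
  qed
  have "nat \<bar>c j\<bar> < p ^ nat \<bar>c j\<bar>"
    using less_exp[of "nat \<bar>c j\<bar>"] power_mono[of 2 p "nat \<bar>c j\<bar>"] prime_ge_2_nat[OF p] by linarith
  then have "int (nat \<bar>c j\<bar>) < int p ^ nat \<bar>c j\<bar>"
    by (metis of_nat_less_iff of_nat_power)
  then show False
    using dvd_imp_le_int[OF c(2) dvd[of "nat \<bar>c j\<bar>"]] by simp
qed

text \<open>A family independent modulo p of maximal length exists by the bound above and spans
  O/pO. Combinations with coefficients in {0..<p} therefore meet every class.\<close>

lemma finite_mod_prime:
  assumes p: "Factorial_Ring.prime p"
  shows "\<exists>R\<subseteq>ints. finite R \<and> (\<forall>y\<in>ints. \<exists>r\<in>R. \<exists>t\<in>ints. y = r + of_nat p * t)"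
proof -
  obtain n where n: "has_degree K n"
    using number_field by (auto simp: number_field_def)
  define indep where "indep = (\<lambda>m x. (\<forall>i<m. x i \<in> ints) \<and>
    (\<forall>c :: nat \<Rightarrow> int. (\<exists>t\<in>ints. (\<Sum>i<m. of_int (c i) * x i) = of_nat p * t) \<longrightarrow>
       (\<forall>i<m. int p dvd c i)))"
  have bound: "m \<le> n" if "\<exists>x. indep m x" for m
    using that indep_mod_prime_bounded[OF n p, of m] unfolding indep_def by blast
  have "\<exists>x. indep 0 x" by (simp add: indep_def)
  then obtain m x where mx: "indep m x" "\<not> (\<exists>x. indep (Suc m) x)"
    using bound GreatestI_nat[of "\<lambda>m. \<exists>x. indep m x" 0 n] Greatest_le_nat[of "\<lambda>m. \<exists>x. indep m x" _ n]
    by (metis Suc_n_not_le_n)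
  have x: "x i \<in> ints" if "i < m" for i
    using mx(1) that by (auto simp: indep_def)
  define comb :: "(nat \<Rightarrow> int) \<Rightarrow> 'a" where "comb = (\<lambda>c. \<Sum>i<m. of_int (c i) * x i)"
  define R where "R = comb ` ({..<m} \<rightarrow>\<^sub>E {0..<int p})"
  have comb: "comb c \<in> ints" for c
    unfolding comb_def by (intro ints_sum ints_closed(4)[OF ints_closed(9) x]) auto
  have "finite R" "R \<subseteq> ints"
    using comb by (auto simp: R_def intro!: finite_PiE)
  moreover have "\<exists>r\<in>R. \<exists>t\<in>ints. y = r + of_nat p * t" if y: "y \<in> ints" for y
  proof -
    have "\<not> indep (Suc m) (x(m := y))"
      using mx(2) by blast
    moreover have "\<forall>i<Suc m. (x(m := y)) i \<in> ints"
      using x y by (simp add: less_Suc_eq)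
    ultimately obtain c :: "nat \<Rightarrow> int" and t j where c: "t \<in> ints" "j < Suc m" "\<not> int p dvd c j"
      "(\<Sum>i<Suc m. of_int (c i) * (x(m := y)) i) = of_nat p * t"
      unfolding indep_def by blast
    have "(\<Sum>i<Suc m. of_int (c i) * (x(m := y)) i) = comb c + of_int (c m) * y"
      unfolding comb_def by simp
    then have ceq: "comb c + of_int (c m) * y = of_nat p * t"
      using c(4) by simp
    \<comment> \<open>Otherwise y could be absorbed into the multiple of p, and the relation would
      concern the independent family alone.\<close>
    have "\<not> int p dvd c m"
    proof
      assume "int p dvd c m"
      then obtain e where e: "c m = int p * e" by blast
      have "comb c = of_nat p * (t - of_int e * y)"
        using ceq e by (simp add: algebra_simps)
      moreover have "t - of_int e * y \<in> ints"
        by (intro ints_closed(6) ints_closed(4)[OF ints_closed(9)] c y)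
      ultimately have "\<forall>i<m. int p dvd c i"
        using mx(1) unfolding indep_def comb_def by blast
      then show False
        using c(2,3) \<open>int p dvd c m\<close> by (auto simp: less_Suc_eq)
    qed
    then have "coprime (c m) (int p)"
      using p by (metis coprime_commute prime_imp_coprime prime_nat_int_transfer)
    then obtain u where "[c m * u = 1] (mod int p)"
      using cong_solve_coprime_int by blast
    then obtain w where w: "c m * u = 1 + int p * w"
      by (metis cong_iff_lin cong_sym)
    define r where "r = (\<lambda>i. if i < m then (- u * c i) mod int p else undefined)"
    have "r \<in> {..<m} \<rightarrow>\<^sub>E {0..<int p}"
      using prime_gt_0_nat[OF p] by (auto simp: r_def PiE_def extensional_def)
    then have "comb r \<in> R" by (auto simp: R_def)
    \<comment> \<open>Multiply the relation by the inverse u of c m modulo p, solve for y, and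
      reduce each coefficient - u * c i to its residue r i; \<open>t'\<close> collects the resulting
      multiples of p.\<close>
    define t' where "t' = comb (\<lambda>i. (- u * c i) div int p) + of_int u * t - of_int w * y"
    have "of_int (- u * c i) * x i = of_int (r i) * x i + of_nat p * (of_int ((- u * c i) div int p) * x i)"
      if "i < m" for i
    proof -
      have "- u * c i = r i + int p * ((- u * c i) div int p)"
        using that by (simp add: r_def)
      then have "(of_int (- u * c i) :: 'a) = of_int (r i) + of_nat p * of_int ((- u * c i) div int p)"
        by (metis of_int_add of_int_mult of_int_of_nat_eq)
      then show ?thesis
        by (metis (no_types, lifting) distrib_right mult.assoc)
    qed
    then have "comb (\<lambda>i. - u * c i) = comb r + of_nat p * comb (\<lambda>i. (- u * c i) div int p)"
      unfolding comb_def sum_distrib_left sum.distrib[symmetric] by (intro sum.cong) auto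
    moreover have "comb (\<lambda>i. - u * c i) = - of_int u * comb c"
      unfolding comb_def sum_distrib_left by (intro sum.cong) auto
    moreover have "of_int u * (of_int (c m) * y) = y + of_nat p * (of_int w * y)"
    proof -
      have "(of_int u * of_int (c m) :: 'a) = of_int (1 + int p * w)"
        using w by (metis of_int_mult mult.commute)
      also have "\<dots> * y = y + of_nat p * (of_int w * y)"
        by (simp add: algebra_simps)
      finally show ?thesis by (simp add: mult.assoc)
    qed
    moreover have "of_int u * comb c + of_int u * (of_int (c m) * y) = of_nat p * (of_int u * t)"
      using ceq by (metis distrib_left mult.left_commute)
    moreover have "Y = r + p * (k + t - w)"
      if "C = r + p * k" "C = - a * b" "v = Y + p * w" "a * b + v = p * t" for Y r p k t w C a b v :: 'a
    proof -
      have "Y = v - p * w" "v = p * t - a * b" "- (a * b) = r + p * k"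
        using that by (simp_all add: eq_diff_eq add.commute)
      then have "Y = (p * t + (r + p * k)) - p * w"
        by (metis diff_conv_add_uminus)
      then show ?thesis by (simp add: algebra_simps)
    qed
    ultimately have "y = comb r + of_nat p * t'"
      unfolding t'_def by blast
    moreover have "t' \<in> ints"
      unfolding t'_def by (intro ints_closed(6,3) ints_closed(4)[OF ints_closed(9)] comb c y)
    ultimately show ?thesis
      using \<open>comb r \<in> R\<close> by blast
  qed
  ultimately show ?thesis
    by (intro exI[of _ R]) auto
qed

text \<open>For d = p e, representatives modulo p and modulo e combine like digits, s + p r.\<close>

lemma finite_mod:
  assumes "d > 0"
  shows "\<exists>R\<subseteq>ints. finite R \<and> (\<forall>y\<in>ints. \<exists>r\<in>R. \<exists>t\<in>ints. y = r + of_nat d * t)"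
  using assms
proof (induction d rule: less_induct)
  case (less d)
  show ?case
  proof (cases "d = 1")
    case True
    have "\<forall>y\<in>ints. \<exists>r\<in>{0}. \<exists>t\<in>ints. y = r + of_nat d * t"
      using True by auto
    then show ?thesis
      using ints_closed(1) by (intro exI[of _ "{0}"]) auto
  next
    case False
    then obtain p where p: "Factorial_Ring.prime p" "p dvd d"
      using prime_factor_nat by blast
    then obtain e where e: "d = p * e" by blast
    have "e < d" "e > 0"
      using prime_gt_1_nat[OF p(1)] less.prems e by auto
    then obtain R where R: "R \<subseteq> ints" "finite R" "\<And>y. y \<in> ints \<Longrightarrow> \<exists>r\<in>R. \<exists>t\<in>ints. y = r + of_nat e * t"
      using less.IH[OF \<open>e < d\<close> \<open>e > 0\<close>] by blast
    obtain S where S: "S \<subseteq> ints" "finite S" "\<And>y. y \<in> ints \<Longrightarrow> \<exists>r\<in>S. \<exists>t\<in>ints. y = r + of_nat p * t"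
      using finite_mod_prime[OF p(1)] by blast
    define U where "U = (\<lambda>(s, r). s + of_nat p * r) ` (S \<times> R)"
    have "U \<subseteq> ints"
    proof
      fix z assume "z \<in> U"
      then obtain s r where "z = s + of_nat p * r" "s \<in> S" "r \<in> R"
        by (auto simp: U_def)
      then show "z \<in> ints"
        using R(1) S(1) ints_closed(3)[OF _ ints_closed(4)[OF ints_closed(8)], of s r p] by auto
    qed
    moreover have "finite U"
      using R(2) S(2) by (auto simp: U_def)
    moreover have "\<exists>u\<in>U. \<exists>t\<in>ints. y = u + of_nat d * t" if y: "y \<in> ints" for y
    proof -
      obtain s t where s: "s \<in> S" "t \<in> ints" "y = s + of_nat p * t"
        using S(3)[OF y] by blast
      obtain r t' where r: "r \<in> R" "t' \<in> ints" "t = r + of_nat e * t'"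
        using R(3)[OF s(2)] by blast
      have "y = (s + of_nat p * r) + of_nat d * t'"
        using s r e by (simp add: algebra_simps)
      moreover have "s + of_nat p * r \<in> U"
        using s(1) r(1) by (auto simp: U_def)
      ultimately show ?thesis
        using r(2) by blast
    qed
    ultimately show ?thesis
      by blast
  qed
qed

lemma pigeonhole_mod:
  assumes "d > 0" and f: "\<And>i::nat. f i \<in> ints"
  obtains i j t where "i < j" "t \<in> ints" "f j = f i + of_nat d * t"
proof -
  obtain R where R: "R \<subseteq> ints" "finite R" "\<forall>y\<in>ints. \<exists>r\<in>R. \<exists>t\<in>ints. y = r + of_nat d * t"
    using finite_mod[OF assms(1)] by blast
  have "\<forall>i. \<exists>r t. r \<in> R \<and> t \<in> ints \<and> f i = r + of_nat d * t"
    using R(3) f by blast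
  then obtain r t where rt: "\<And>i. r i \<in> R" "\<And>i. t i \<in> ints" "\<And>i. f i = r i + of_nat d * t i"
    by metis
  have "finite (range r)"
    using R(2) rt(1) by (auto intro: finite_subset)
  then have "\<not> inj r"
    using finite_imageD[of r UNIV] infinite_UNIV_nat by blast
  then obtain i j where "i < j" "r i = r j"
    unfolding inj_def by (metis linorder_neqE_nat)
  then have "f j = f i + of_nat d * (t j - t i)"
    using rt(3)[of i] rt(3)[of j] by (simp add: algebra_simps)
  then show ?thesis
    using that[OF \<open>i < j\<close> ints_closed(6)[OF rt(2,2)]] by blast
qed

text \<open>Modulo \<open>d\<O>\<close> two of the elements \<open>d g\<^sup>k\<close> agree, so \<open>g\<^sup>j - g\<^sup>i\<close> is integral for some \<open>i < j\<close>.\<close>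

lemma completely_integrally_closed:
  assumes g: "g \<in> K" and a: "a \<in> ints" "a \<noteq> 0" and ga: "\<And>k. g ^ k * a \<in> ints"
  shows "g \<in> ints"
proof -
  obtain d :: nat and e where d: "d > 0" "e \<in> ints" "a * e = of_nat d"
    using int_multiple_of_int[OF a] by blast
  have "of_nat d * g ^ k \<in> ints" for k
  proof -
    have "g ^ k * a * e = of_nat d * g ^ k"
      using d(3) by (metis mult.assoc mult.commute)
    then show ?thesis
      using ints_closed(4)[OF ga[of k] d(2)] by (simp only:)
  qed
  then obtain i j t where ij: "i < j" "t \<in> ints" "of_nat d * g ^ j = of_nat d * g ^ i + of_nat d * t"
    using pigeonhole_mod[OF d(1), of "\<lambda>k. of_nat d * g ^ k"] by blast
  then have t: "g ^ j = g ^ i + t"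
    using d(1) by (metis distrib_left mult_cancel_left of_nat_eq_0_iff less_not_refl)
  \<comment> \<open>g satisfies the monic equation X^j - X^i = t, whose right-hand side is an
    algebraic integer and not necessarily a rational one; \<open>algebraic_int_root\<close> handles
    this form.\<close>
  define p where "p = Polynomial.monom (1::'a) j - Polynomial.monom 1 i"
  have deg: "Polynomial.degree p = j"
    using ij(1) by (intro antisym[OF degree_le le_degree]) (auto simp: p_def coeff_monom)
  have "algebraic_int g"
  proof (rule algebraic_int_root)
    show "algebraic_int t" using ij(2) by simp
    show "poly p g = t" using t by (simp add: p_def poly_monom)
    show "\<forall>i. Polynomial.coeff p i \<in> \<int>" by (auto simp: p_def coeff_monom)
    show "Polynomial.lead_coeff p = 1" unfolding deg using ij(1) by (auto simp: p_def coeff_monom)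
    show "Polynomial.degree p > 0" using deg ij(1) by simp
  qed
  then show ?thesis using g by simp
qed

end

section \<open>Prime ideals and their powers\<close>

context number_field_loc
begin

lemma O_simps [simp]:
  "carrier (\<O> K) = ints" "x \<otimes>\<^bsub>\<O> K\<^esub> y = x * y" "x \<oplus>\<^bsub>\<O> K\<^esub> y = x + y"
  "\<one>\<^bsub>\<O> K\<^esub> = 1" "\<zero>\<^bsub>\<O> K\<^esub> = 0"
  by (simp_all add: ring_of_integers_def)

lemma cring_O: "cring (\<O> K)"
proof -
  interpret R: field "ambient :: 'a ring" by (rule field_from_type_algebra)
  have "subcring ints ambient"
  proof (rule R.subcringI'[OF R.subringI])
    show "\<one>\<^bsub>ambient\<^esub> \<in> ints" using ints_closed(2) by simp
    show "\<ominus>\<^bsub>ambient\<^esub> h \<in> ints" if "h \<in> ints" for h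
      using ints_closed(5)[OF that] by simp
    show "h1 \<otimes>\<^bsub>ambient\<^esub> h2 \<in> ints" if "h1 \<in> ints" "h2 \<in> ints" for h1 h2
      using ints_closed(4)[OF that] by simp
    show "h1 \<oplus>\<^bsub>ambient\<^esub> h2 \<in> ints" if "h1 \<in> ints" "h2 \<in> ints" for h1 h2
      using ints_closed(3)[OF that] by simp
  qed simp
  then show ?thesis
    unfolding ring_of_integers_def by (rule R.subcring_iff[THEN iffD1, rotated]) auto
qed

end

locale prime_loc = number_field_loc +
  fixes P :: "'a set"
  assumes P: "P \<in> nonzero_primes K"
begin

lemma primeideal_P: "primeideal P (\<O> K)" and P_nonzero: "P \<noteq> {0}"
  using P by (auto simp: nonzero_primes_def)

lemma ideal_P: "ideal P (\<O> K)"
  using primeideal_P by (rule primeideal.axioms(1))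

lemma P_subset: "x \<in> P \<Longrightarrow> x \<in> ints"
  using ideal.Icarr[OF ideal_P] by simp

lemma P_zero: "0 \<in> P"
  using additive_subgroup.zero_closed[OF ideal.axioms(1)[OF ideal_P]] by simp

lemma P_add: "x \<in> P \<Longrightarrow> y \<in> P \<Longrightarrow> x + y \<in> P"
  using additive_subgroup.a_closed[OF ideal.axioms(1)[OF ideal_P]] by simp

lemma P_mult: "x \<in> ints \<Longrightarrow> y \<in> P \<Longrightarrow> x * y \<in> P"
  using ideal.I_l_closed[OF ideal_P, of y x] by simp

lemma P_mult': "x \<in> P \<Longrightarrow> y \<in> ints \<Longrightarrow> x * y \<in> P"
  using P_mult[of y x] by (simp add: mult.commute)

lemma P_diff: "x \<in> P \<Longrightarrow> y \<in> P \<Longrightarrow> x - y \<in> P"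
  using P_add[OF _ P_mult[OF ints_closed(5)[OF ints_closed(2)]], of x y] by simp

lemma P_prime: "x \<in> ints \<Longrightarrow> y \<in> ints \<Longrightarrow> x * y \<in> P \<Longrightarrow> x \<in> P \<or> y \<in> P"
  using primeideal.I_prime[OF primeideal_P, of x y] by simp

lemma P_one: "1 \<notin> P"
proof
  assume "1 \<in> P"
  have "P = ints"
  proof
    show "ints \<subseteq> P"
    proof
      fix x assume "x \<in> ints"
      then show "x \<in> P" using P_mult[OF _ \<open>1 \<in> P\<close>, of x] by simp
    qed
  qed (use P_subset in blast)
  then show False
    using primeideal.I_notcarr[OF primeideal_P] by simp
qed

lemma P_power: "x \<in> ints \<Longrightarrow> x ^ k \<in> P \<Longrightarrow> x \<in> P"
proof (induction k)
  case 0
  then show ?case using P_one by simp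
next
  case (Suc k)
  have "x \<in> P \<or> x ^ k \<in> P"
    by (rule P_prime[OF Suc.prems(1) ints_closed(7)[OF Suc.prems(1)]]) (use Suc.prems(2) in simp)
  then show ?case using Suc.IH[OF Suc.prems(1)] by blast
qed

lemma prod_notin_P:
  assumes "\<And>i. i \<in> I \<Longrightarrow> f i \<in> ints \<and> f i \<notin> P"
  shows "prod f I \<in> ints \<and> prod f I \<notin> P"
  using assms
proof (induction I rule: infinite_finite_induct)
  case (insert i I)
  have "f i \<in> ints" "f i \<notin> P" "prod f I \<in> ints" "prod f I \<notin> P"
    using insert.prems[of i] insert.IH insert.prems by auto
  then show ?case
    using P_prime[of "f i" "prod f I"] ints_closed(4)[of "f i" "prod f I"] insert.hyps by auto
qed (use P_one ints_closed(2) in auto)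

text \<open>P contains a positive integer, namely a multiple of any of its nonzero elements.
  Primality passes to a prime factor q, and an integer of P prime to q would put 1 into P by
  Bezout.\<close>

lemma lies_over_exists: "\<exists>p. lies_over P p"
proof -
  obtain a where a: "a \<in> P" "a \<noteq> 0"
    using P_nonzero P_zero by blast
  obtain d :: nat and e where d: "d > 0" "e \<in> ints" "a * e = of_nat d"
    using int_multiple_of_int[OF P_subset[OF a(1)] a(2)] by blast
  have "\<exists>q. Factorial_Ring.prime q \<and> of_nat q \<in> P" if "of_nat d \<in> P" "d > 0" for d :: nat
    using that
  proof (induction d rule: less_induct)
    case (less d)
    then have "d \<noteq> 1" using P_one by auto
    then obtain q where q: "Factorial_Ring.prime q" "q dvd d"
      using prime_factor_nat by blast
    then obtain e where e: "d = q * e" by blast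
    have "e < d" "e > 0"
      using prime_gt_1_nat[OF q(1)] less.prems e by auto
    have "of_nat q \<in> P \<or> of_nat e \<in> P"
      using less.prems(1) unfolding e by (intro P_prime ints_closed(8)) simp
    then show ?case
      using q(1) less.IH[OF \<open>e < d\<close> _ \<open>e > 0\<close>] by blast
  qed
  moreover have "of_nat d \<in> P"
    using P_mult'[OF a(1) d(2)] d(3) by simp
  ultimately obtain q where q: "Factorial_Ring.prime q" "of_nat q \<in> P"
    using d(1) by blast
  have "of_int m \<in> P \<longleftrightarrow> int q dvd m" for m
  proof
    assume "int q dvd m"
    then obtain k where "m = k * int q" by (metis dvdE mult.commute)
    then show "of_int m \<in> P"
      using P_mult[OF ints_closed(9) q(2), of k] by simp
  next
    assume m: "of_int m \<in> P"
    show "int q dvd m"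
    proof (rule ccontr)
      assume "\<not> int q dvd m"
      then have "coprime (int q) m"
        using q(1) by (metis prime_imp_coprime prime_nat_int_transfer)
      then obtain u v where "u * int q + v * m = 1"
        using bezout_int[of "int q" m] by auto
      then have "(of_int (u * int q + v * m) :: 'a) = 1"
        by (simp del: of_int_add of_int_mult)
      moreover have "of_int u * of_nat q + of_int v * of_int m \<in> P"
        by (intro P_add P_mult ints_closed(9) q m)
      ultimately show False
        using P_one by simp
    qed
  qed
  then show ?thesis
    using q(1) unfolding lies_over_def by blast
qed

lemma lies_over_unique: "lies_over P p \<Longrightarrow> lies_over P q \<Longrightarrow> p = q"
proof -
  assume pq: "lies_over P p" "lies_over P q"
  then have "of_int (int q) \<in> P"
    by (simp only: lies_over_def dvd_refl)
  then have "int p dvd int q"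
    using pq(1) by (simp only: lies_over_def)
  then show "p = q"
    using pq primes_dvd_imp_eq[of p q] by (simp add: lies_over_def)
qed

lemma prime_below_eqI: "lies_over P p \<Longrightarrow> prime_below P = p"
  unfolding prime_below_def by (rule the_equality) (assumption, erule lies_over_unique)

lemma lies_over_prime_below: "lies_over P (prime_below P)"
proof -
  obtain p where p: "lies_over P p" using lies_over_exists ..
  then show ?thesis unfolding prime_below_eqI[OF p] .
qed

abbreviation p0 :: nat where "p0 \<equiv> prime_below P"

lemma prime_p0: "Factorial_Ring.prime p0"
  using lies_over_prime_below unfolding lies_over_def by (rule conjunct1)

lemma of_int_in_P_iff: "of_int m \<in> P \<longleftrightarrow> int p0 dvd m"
  using lies_over_prime_below unfolding lies_over_def by (rule conjunct2[THEN spec])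

lemma of_nat_in_P_iff: "of_nat m \<in> P \<longleftrightarrow> p0 dvd m"
  using of_int_in_P_iff[of "int m"] by (simp only: of_int_of_nat_eq int_dvd_int_iff)

lemma p0_in_P: "of_nat p0 \<in> P"
  by (simp only: of_nat_in_P_iff dvd_refl)

text \<open>A finite domain is a field: the powers of s repeat modulo p, and cancelling s^i modulo P
  leaves 1 on one side and s^(j - i) on the other. So e = s^(j - i - 1) inverts s.\<close>

lemma P_maximal:
  assumes s: "s \<in> ints" "s \<notin> P"
  obtains e where "e \<in> ints" "1 - e * s \<in> P"
proof -
  obtain i j t where ij: "i < j" "t \<in> ints" "s ^ j = s ^ i + of_nat p0 * t"
    by (rule pigeonhole_mod[of p0 "\<lambda>k. s ^ k", OF prime_gt_0_nat[OF prime_p0] ints_closed(7)[OF s(1)]])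
  define k where "k = j - i - 1"
  have "s ^ j = s ^ i * (s ^ k * s)"
  proof -
    have "j = i + Suc k" using ij(1) by (simp add: k_def)
    then show ?thesis by (simp add: power_add mult.commute)
  qed
  then have "s ^ i * (1 - s ^ k * s) = - t * of_nat p0"
    using ij(3) by (simp add: algebra_simps)
  moreover have "- t * of_nat p0 \<in> P"
    by (intro P_mult ints_closed(5) ij p0_in_P)
  ultimately have "s ^ i \<in> P \<or> 1 - s ^ k * s \<in> P"
    using s(1) by (intro P_prime ints_closed(6,2,7) ints_closed(4)[OF ints_closed(7)]) auto
  then have "1 - s ^ k * s \<in> P"
    using P_power s by blast
  then show ?thesis
    using that[OF ints_closed(7)[OF s(1)]] by blast
qed

text \<open>The finite ring \<open>\<O>/p\<O>\<close> has a nonzero element \<open>b\<close> annihilated by \<open>P\<close>, found by localising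
  at \<open>P\<close>: \<open>N\<close> is the kernel of the localisation, and \<open>x\<close> generates a minimal nonzero ideal of it.\<close>

lemma exists_nonintegral_multiplier: "\<exists>g\<in>K. g \<notin> ints \<and> (\<forall>x\<in>P. g * x \<in> ints)"
proof -
  let ?p = "of_nat p0 :: 'a"
  have p_int: "?p \<in> ints"
    by (rule ints_closed(8))
  have p_nz: "?p \<noteq> 0"
    using prime_gt_0_nat[OF prime_p0] by simp
  obtain R where R: "R \<subseteq> ints" "finite R" "\<forall>y\<in>ints. \<exists>r\<in>R. \<exists>t\<in>ints. y = r + ?p * t"
    using finite_mod_prime[OF prime_p0] by blast
  define pO where "pO = (\<lambda>t. ?p * t) ` ints"
  have pO_sub: "z \<in> ints" "z \<in> P" if "z \<in> pO" for z
    using that p_int ints_closed(4)[OF p_int] P_mult'[OF p0_in_P] by (auto simp: pO_def)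
  have pO_mult: "z * y \<in> pO" if z: "z \<in> pO" and y: "y \<in> ints" for y z
  proof -
    obtain t where t: "t \<in> ints" "z = ?p * t" using z by (auto simp: pO_def)
    then have "z * y = ?p * (t * y)" by (simp add: mult.assoc)
    then show ?thesis using ints_closed(4)[OF t(1) y] unfolding pO_def by blast
  qed
  have pO_add: "z * a + y * b \<in> pO" if z: "z \<in> pO" "y \<in> pO" and ab: "a \<in> ints" "b \<in> ints" for y z a b
  proof -
    obtain t u where t: "t \<in> ints" "z = ?p * t" "u \<in> ints" "y = ?p * u" using z by (auto simp: pO_def)
    then have "z * a + y * b = ?p * (t * a + u * b)" by (simp add: algebra_simps)
    moreover have "t * a + u * b \<in> ints"
      using ints_closed(3)[OF ints_closed(4)[OF t(1) ab(1)] ints_closed(4)[OF t(3) ab(2)]] .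
    ultimately show ?thesis unfolding pO_def by blast
  qed
  define N where "N = {x \<in> ints. \<exists>s\<in>ints. s \<notin> P \<and> s * x \<in> pO}"
  have N_int: "x \<in> ints" if "x \<in> N" for x using that by (simp add: N_def)
  have "1 \<notin> N"
    using pO_sub(2) by (auto simp: N_def)
  have pO_N: "z \<in> N" if "z \<in> pO" for z
    using pO_sub(1)[OF that] that ints_closed(2) P_one unfolding N_def by (auto intro!: bexI[of _ 1])
  have N_add: "x + y \<in> N" if xy: "x \<in> N" "y \<in> N" for x y
  proof -
    obtain s t where st: "s \<in> ints" "s \<notin> P" "s * x \<in> pO" "t \<in> ints" "t \<notin> P" "t * y \<in> pO"
      using xy by (auto simp: N_def)
    have "(s * t) * (x + y) = (s * x) * t + (t * y) * s"
      by (simp add: algebra_simps)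
    then have "(s * t) * (x + y) \<in> pO"
      using pO_add[OF st(3,6,4,1)] by simp
    moreover have "s * t \<in> ints" "s * t \<notin> P"
      using ints_closed(4)[OF st(1,4)] P_prime[OF st(1,4)] st by auto
    ultimately show ?thesis
      using ints_closed(3)[OF N_int[OF xy(1)] N_int[OF xy(2)]] unfolding N_def by blast
  qed
  have N_mult: "x \<in> N" if x: "x \<in> ints" "s \<in> ints" "s \<notin> P" "s * x \<in> N" for s x
  proof -
    obtain t where t: "t \<in> ints" "t \<notin> P" "t * (s * x) \<in> pO"
      using x(4) by (auto simp: N_def)
    then have "(t * s) * x \<in> pO" "t * s \<in> ints" "t * s \<notin> P"
      using ints_closed(4)[OF t(1) x(2)] P_prime[OF t(1) x(2)] x by (auto simp: mult.assoc)
    then show ?thesis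
      using x(1) unfolding N_def by blast
  qed
  \<comment> \<open>\<open>M x\<close> consists of the representatives lying in the ideal x O + N.
    The cardinality serves as the size of that ideal, so that a minimal one can be chosen.\<close>
  define M where "M = (\<lambda>x. {r \<in> R. \<exists>y\<in>ints. r - x * y \<in> N})"
  have finM: "finite (M x)" for x
    using R(2) by (simp add: M_def)
  have "\<exists>x. x \<in> ints \<and> x \<notin> N \<and> (\<forall>y. y \<in> ints \<and> y \<notin> N \<longrightarrow> card (M x) \<le> card (M y))"
    using ex_has_least_nat[of "\<lambda>x. x \<in> ints \<and> x \<notin> N" 1 "\<lambda>x. card (M x)"] \<open>1 \<notin> N\<close> ints_closed(2)
    by blast
  then obtain x where x: "x \<in> ints" "x \<notin> N" and min: "\<And>y. y \<in> ints \<Longrightarrow> y \<notin> N \<Longrightarrow> card (M x) \<le> card (M y)"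
    by blast
  have mx: "m * x \<in> N" if m: "m \<in> P" for m
  proof (rule ccontr)
    assume mxN: "m * x \<notin> N"
    have m_int: "m \<in> ints" using P_subset[OF m] .
    have "M (m * x) \<subseteq> M x"
    proof
      fix r assume "r \<in> M (m * x)"
      then obtain y where y: "r \<in> R" "y \<in> ints" "r - m * x * y \<in> N" by (auto simp: M_def)
      have "r - x * (m * y) \<in> N" using y(3) by (simp add: mult_ac)
      then show "r \<in> M x"
        using y(1) ints_closed(4)[OF m_int y(2)] unfolding M_def by blast
    qed
    moreover have "card (M x) \<le> card (M (m * x))"
      using min[OF ints_closed(4)[OF m_int x(1)] mxN] .
    \<comment> \<open>Nakayama in miniature: by minimality m x and x generate the same ideal modulo
      N, so (1 - m y) x lies in N for some y. As 1 - m y is outside P, it can be cancelled,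
      contradicting the choice of x.\<close>
    ultimately have eq: "M (m * x) = M x"
      using finM card_seteq by blast
    obtain r t where r: "r \<in> R" "t \<in> ints" "x = r + ?p * t"
      using R(3) x(1) by blast
    have "r - x * 1 = ?p * (- t)"
      using r(3) by (simp add: algebra_simps)
    then have "r - x * 1 \<in> N"
      using pO_N ints_closed(5)[OF r(2)] unfolding pO_def by blast
    then have "r \<in> M x"
      using r(1) ints_closed(2) unfolding M_def by blast
    then have "r \<in> M (m * x)"
      using eq by simp
    then obtain y where y: "y \<in> ints" "r - m * x * y \<in> N"
      by (auto simp: M_def)
    have "?p * t \<in> N"
      using pO_N r(2) unfolding pO_def by blast
    then have "(r - m * x * y) + ?p * t \<in> N"
      using N_add y(2) by blast
    moreover have "(r - m * x * y) + ?p * t = (1 - m * y) * x"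
      using r(3) by (simp add: algebra_simps)
    ultimately have "(1 - m * y) * x \<in> N"
      by simp
    moreover have "1 - m * y \<notin> P"
      using P_add[OF _ P_mult'[OF m y(1)], of "1 - m * y"] P_one by auto
    moreover have "1 - m * y \<in> ints"
      using ints_closed(6)[OF ints_closed(2) ints_closed(4)[OF m_int y(1)]] .
    ultimately show False
      using N_mult[OF x(1)] x(2) by blast
  qed
  have "\<forall>m\<in>R \<inter> P. \<exists>s. s \<in> ints \<and> s \<notin> P \<and> s * (m * x) \<in> pO"
    using mx by (auto simp: N_def)
  then obtain s where s: "\<And>m. m \<in> R \<inter> P \<Longrightarrow> s m \<in> ints \<and> s m \<notin> P \<and> s m * (m * x) \<in> pO"
    by metis
  \<comment> \<open>The multipliers that bring m x into pO vary with m. The product of these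
    finitely many multipliers is still outside P and works for all representatives in P; S x stays
    outside pO because x is not in N.\<close>
  define S where "S = prod s (R \<inter> P)"
  have S: "S \<in> ints" "S \<notin> P"
    using prod_notin_P[of "R \<inter> P" s] s by (auto simp: S_def)
  define b where "b = S * x"
  have b: "b \<in> ints" "b \<notin> pO"
    using ints_closed(4)[OF S(1) x(1)] x S by (auto simp: b_def N_def)
  have Sm: "b * m \<in> pO" if m: "m \<in> R \<inter> P" for m
  proof -
    have "S = s m * prod s (R \<inter> P - {m})"
      unfolding S_def using m R(2) by (intro prod.remove) auto
    then have "b * m = s m * (m * x) * prod s (R \<inter> P - {m})"
      by (simp add: b_def mult_ac)
    moreover have "prod s (R \<inter> P - {m}) \<in> ints"
      using s by (intro ints_prod) auto
    ultimately show ?thesis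
      using pO_mult[of "s m * (m * x)" "prod s (R \<inter> P - {m})"] s[OF m] by (simp only:)
  qed
  have bP: "b * y \<in> pO" if y: "y \<in> P" for y
  proof -
    obtain r t where r: "r \<in> R" "t \<in> ints" "y = r + ?p * t"
      using R(3) P_subset[OF y] by blast
    have "r = y - ?p * t" using r(3) by simp
    then have "r \<in> P"
      using P_diff[OF y P_mult'[OF p0_in_P r(2)]] by simp
    then have "b * r \<in> pO" using Sm r(1) by simp
    moreover have "?p \<in> pO"
      using ints_closed(2) by (auto simp: pO_def intro!: image_eqI[of _ _ 1])
    ultimately have "b * r * 1 + ?p * (t * b) \<in> pO"
      by (intro pO_add ints_closed(2) ints_closed(4) r(2) b(1))
    then show ?thesis
      using r(3) by (simp add: algebra_simps)
  qed
  \<comment> \<open>b is not divisible by p in O although all of b P is, so b / p is the desired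
    multiplier.\<close>
  have "b / ?p \<in> K"
    using K_closed(8)[OF _ K_closed(10)] b(1) by simp
  moreover have "b / ?p \<notin> ints"
  proof
    assume "b / ?p \<in> ints"
    then have "?p * (b / ?p) \<in> pO" unfolding pO_def by blast
    then show False using b(2) p_nz by simp
  qed
  moreover have "b / ?p * y \<in> ints" if "y \<in> P" for y
  proof -
    obtain t where "t \<in> ints" "b * y = ?p * t"
      using bP[OF \<open>y \<in> P\<close>] by (auto simp: pO_def)
    then show ?thesis
      using p_nz by (simp add: field_simps)
  qed
  ultimately show ?thesis
    by blast
qed

section \<open>Powers of P and the order of an integer at P\<close>

abbreviation Ppow :: "nat \<Rightarrow> 'a set"
  where "Ppow k \<equiv> P [^]\<^bsub>ideals_set (\<O> K)\<^esub> k"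

lemma Ppow_simps: "Ppow 0 = ints" "Ppow (Suc k) = ideal_prod (\<O> K) (Ppow k) P"
  by (simp_all add: nat_pow_def ideals_set_def)

lemma ideal_Ppow: "ideal (Ppow k) (\<O> K)"
proof (induction k)
  case 0
  interpret R: cring "\<O> K" by (rule cring_O)
  show ?case using R.oneideal unfolding Ppow_simps by simp
next
  case (Suc k)
  interpret R: cring "\<O> K" by (rule cring_O)
  show ?case
    unfolding Ppow_simps by (rule R.ideal_prod_is_ideal[OF Suc ideal_P])
qed

lemma Ppow_Suc_subset: "Ppow (Suc k) \<subseteq> P"
proof -
  interpret R: cring "\<O> K" by (rule cring_O)
  show ?thesis
    unfolding Ppow_simps using R.ideal_prod_inter[OF ideal_Ppow ideal_P] by blast
qed

lemma power_in_Ppow: "x \<in> P \<Longrightarrow> x ^ k \<in> Ppow k"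
proof (induction k)
  case (Suc k)
  then have "x ^ k \<otimes>\<^bsub>\<O> K\<^esub> x \<in> Ppow (Suc k)"
    unfolding Ppow_simps by (intro ideal_prod.prod) auto
  then show ?case by (simp add: mult.commute)
qed (use ints_closed(2) Ppow_simps in simp)

lemma Ppow_mult_integral:
  assumes g: "\<And>x. x \<in> P \<Longrightarrow> g * x \<in> ints" and "a \<in> Ppow k"
  shows "g ^ k * a \<in> ints"
  using assms(2)
proof (induction k arbitrary: a)
  case 0
  then show ?case unfolding Ppow_simps by simp
next
  case (Suc k)
  from Suc.prems have "a \<in> ideal_prod (\<O> K) (Ppow k) P"
    unfolding Ppow_simps .
  then show ?case
  proof (induction a rule: ideal_prod.induct)
    case (prod i j)
    have "g ^ Suc k * (i \<otimes>\<^bsub>\<O> K\<^esub> j) = (g ^ k * i) * (g * j)"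
      by (simp add: mult_ac)
    then show ?case
      using ints_closed(4)[OF Suc.IH[OF prod(1)] g[OF prod(2)]] by (simp only:)
  next
    case (sum a b)
    then show ?case
      using ints_closed(3)[OF sum(3,4)] by (simp only: O_simps distrib_left)
  qed
qed

text \<open>Locally at P the element g is the inverse of a uniformizer. Membership in P^k, which is
  defined through sums of products, thereby becomes integrality of a single element.\<close>

lemma exists_localizer:
  obtains g where "g \<in> K" "g \<notin> ints" "\<And>a k. a \<in> ints \<Longrightarrow> a \<in> Ppow k \<longleftrightarrow> g ^ k * a \<in> ints"
    "\<And>a. a \<in> ints \<Longrightarrow> a \<in> P \<longleftrightarrow> g * a \<in> ints"
proof -
  obtain g where g: "g \<in> K" "g \<notin> ints" "\<And>x. x \<in> P \<Longrightarrow> g * x \<in> ints"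
    using exists_nonintegral_multiplier by blast
  \<comment> \<open>If g mapped P into itself, every g^k p0 would be integral, and then so would g
    by complete integral closedness.\<close>
  have "\<exists>\<pi>\<in>P. g * \<pi> \<notin> P"
  proof (rule ccontr)
    assume "\<not> ?thesis"
    then have gP: "g * x \<in> P" if "x \<in> P" for x
      using that by blast
    have "g ^ k * of_nat p0 \<in> P" for k
    proof (induction k)
      case (Suc k)
      then show ?case using gP[OF Suc] by (simp add: mult.assoc)
    qed (use p0_in_P in simp)
    then have "g \<in> ints"
      using prime_gt_0_nat[OF prime_p0]
      by (intro completely_integrally_closed[OF g(1) ints_closed(8)[of p0]] P_subset) auto
    then show False using g(2) by blast
  qed
  then obtain \<pi> where pi: "\<pi> \<in> P" "g * \<pi> \<notin> P" by blast
  \<comment> \<open>Since s is invertible modulo P, \<open>\<pi>\<close> is a uniformizer at P and g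
    its inverse up to a local unit.\<close>
  define s where "s = g * \<pi>"
  have s: "s \<in> ints" "s \<notin> P"
    using g(3)[OF pi(1)] pi(2) by (auto simp: s_def)
  have mem: "a \<in> Ppow k" if a: "a \<in> ints" "g ^ k * a \<in> ints" for a k
  proof -
    interpret I: ideal "Ppow k" "\<O> K" by (rule ideal_Ppow)
    have "s ^ k \<notin> P" using P_power s by blast
    then obtain e where e: "e \<in> ints" "1 - e * s ^ k \<in> P"
      using P_maximal[OF ints_closed(7)[OF s(1)]] by blast
    \<comment> \<open>Put t = 1 - e s^k, an element of P. Then t^k lies in P^k, while 1 - t^k = e
      s^k f is a multiple of s^k = g^k \<pi>^k. Multiplying by a exhibits a as t^k a plus an
      integral multiple of \<pi>^k.\<close>
    define f where "f = (\<Sum>i<k. (1 - e * s ^ k) ^ i)"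
    have es: "e * s ^ k \<in> ints" using ints_closed(4)[OF e(1) ints_closed(7)[OF s(1)]] .
    have f: "f \<in> ints"
      unfolding f_def by (intro ints_sum ints_closed(7) ints_closed(6) ints_closed(2) es)
    have "1 - (1 - e * s ^ k) ^ k = (e * s ^ k) * f"
      unfolding f_def by (simp add: one_diff_power_eq)
    then have a_eq: "a = (1 - e * s ^ k) ^ k * a + (e * f * (g ^ k * a)) * \<pi> ^ k"
    proof -
      have "s ^ k = g ^ k * \<pi> ^ k" by (simp add: s_def power_mult_distrib)
      then have "(e * f * (g ^ k * a)) * \<pi> ^ k = (e * s ^ k) * f * a" by (simp add: mult_ac)
      also have "\<dots> = (1 - (1 - e * s ^ k) ^ k) * a"
        using \<open>1 - (1 - e * s ^ k) ^ k = (e * s ^ k) * f\<close> by simp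
      finally show ?thesis by (simp add: left_diff_distrib)
    qed
    have 1: "(1 - e * s ^ k) ^ k * a \<in> Ppow k"
      using I.I_r_closed[OF power_in_Ppow[OF e(2)], of a] a(1) by simp
    have 2: "(e * f * (g ^ k * a)) * \<pi> ^ k \<in> Ppow k"
      using I.I_l_closed[OF power_in_Ppow[OF pi(1)], of "e * f * (g ^ k * a)"]
        ints_closed(4)[OF ints_closed(4)[OF e(1) f] a(2)] by simp
    have "(1 - e * s ^ k) ^ k * a + (e * f * (g ^ k * a)) * \<pi> ^ k \<in> Ppow k"
      using additive_subgroup.a_closed[OF ideal.axioms(1)[OF ideal_Ppow] 1 2] by (simp only: O_simps)
    then show ?thesis
      using a_eq by simp
  qed
  have "a \<in> Ppow k \<longleftrightarrow> g ^ k * a \<in> ints" if "a \<in> ints" for a k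
    using mem[OF that] Ppow_mult_integral[OF g(3)] by blast
  moreover have "a \<in> P \<longleftrightarrow> g * a \<in> ints" if "a \<in> ints" for a
    using mem[OF that, of 1] Ppow_Suc_subset[of 0] g(3) by auto
  ultimately show ?thesis
    using that g(1,2) by blast
qed

text \<open>The order of a is the exponent k for which g^k a is integral but outside P. The integers
  outside P are closed under multiplication, so these exponents add.\<close>

lemma
  assumes a: "a \<in> ints" "a \<noteq> 0"
  shows ord_integer_mult: "b \<in> ints \<Longrightarrow> b \<noteq> 0 \<Longrightarrow>
      ord_integer K P (a * b) = ord_integer K P a + ord_integer K P b"
    and ord_integer_eq_0_iff: "ord_integer K P a = 0 \<longleftrightarrow> a \<notin> P"
proof -
  obtain g where g: "g \<in> K" "g \<notin> ints" "\<And>a k. a \<in> ints \<Longrightarrow> a \<in> Ppow k \<longleftrightarrow> g ^ k * a \<in> ints"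
    "\<And>a. a \<in> ints \<Longrightarrow> a \<in> P \<longleftrightarrow> g * a \<in> ints"
    using exists_localizer by blast
  have ordI: "ord_integer K P a = k" if a: "a \<in> ints" and k: "g ^ k * a \<in> ints" "g ^ k * a \<notin> P" for a k
    unfolding ord_integer_def
  proof (rule Greatest_equality)
    show "a \<in> Ppow k" using g(3)[OF a] k(1) by blast
    fix y assume y: "a \<in> Ppow y"
    show "y \<le> k"
    proof (rule ccontr)
      assume "\<not> y \<le> k"
      then obtain j where j: "y = Suc j + k"
        by (metis add.commute less_imp_Suc_add linorder_not_le add_Suc_right)
      have "g ^ Suc j * (g ^ k * a) \<in> ints"
        using y g(3)[OF a, of y] unfolding j by (simp add: power_add mult_ac)
      then have "g ^ k * a \<in> Ppow (Suc j)"
        using g(3)[OF k(1), of "Suc j"] by blast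
      then show False
        using Ppow_Suc_subset k(2) by blast
    qed
  qed
  have ordE: "\<exists>k. g ^ k * a \<in> ints \<and> g ^ k * a \<notin> P" if a: "a \<in> ints" "a \<noteq> 0" for a
  proof -
    \<comment> \<open>If all g^k a were integral, g would be integral. The least exponent that fails
      is positive because a itself is integral, and its predecessor is the order.\<close>
    have "\<exists>k. g ^ k * a \<notin> ints"
      using completely_integrally_closed[OF g(1) a] g(2) by blast
    define k where "k = (LEAST k. g ^ k * a \<notin> ints)"
    have k: "g ^ k * a \<notin> ints"
      unfolding k_def by (rule LeastI_ex) fact
    then obtain j where j: "k = Suc j"
      using a(1) by (cases k) auto
    have "g ^ j * a \<in> ints"
      using not_less_Least[of j "\<lambda>k. g ^ k * a \<notin> ints"] j unfolding k_def by auto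
    moreover have "g * (g ^ j * a) \<notin> ints"
      using k j by (simp add: mult.assoc)
    ultimately show ?thesis
      using g(4) by blast
  qed
  obtain k where k: "g ^ k * a \<in> ints" "g ^ k * a \<notin> P"
    using ordE[OF a] by blast
  show "ord_integer K P (a * b) = ord_integer K P a + ord_integer K P b" if b: "b \<in> ints" "b \<noteq> 0"
  proof -
    obtain l where l: "g ^ l * b \<in> ints" "g ^ l * b \<notin> P"
      using ordE[OF b] by blast
    have eq: "g ^ (k + l) * (a * b) = (g ^ k * a) * (g ^ l * b)"
      by (simp add: power_add mult_ac)
    have "g ^ (k + l) * (a * b) \<in> ints"
      unfolding eq using ints_closed(4)[OF k(1) l(1)] .
    moreover have "g ^ (k + l) * (a * b) \<notin> P"
      unfolding eq using P_prime[OF k(1) l(1)] k(2) l(2) by blast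
    ultimately show ?thesis
      using ordI[OF ints_closed(4)[OF a(1) b(1)]] ordI[OF a(1) k] ordI[OF b(1) l] by metis
  qed
  show "ord_integer K P a = 0 \<longleftrightarrow> a \<notin> P"
  proof
    assume "a \<notin> P"
    then show "ord_integer K P a = 0" using ordI[OF a(1), of 0] a(1) by simp
  next
    assume "ord_integer K P a = 0"
    then have "k = 0" using ordI[OF a(1) k] by simp
    then show "a \<notin> P" using k by simp
  qed
qed

end

section \<open>Valuations and lying over\<close>

context number_field_loc
begin

lemma quotient_of_integers:
  assumes "x \<in> K" "x \<noteq> 0"
  obtains a b where "a \<in> ints" "a \<noteq> 0" "b \<in> ints" "b \<noteq> 0" "x = a / b"
proof -
  obtain d :: nat where d: "d > 0" "of_nat d * x \<in> ints"
    by (rule int_multiple_integral[OF assms(1)])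
  show ?thesis
    by (rule that[OF d(2) _ ints_closed(8)[of d]]) (use assms(2) d(1) in auto)
qed

text \<open>A prime containing a contains a positive integer d, hence is a union of classes modulo d
  and is determined by its trace on a finite set of representatives.\<close>

lemma finite_primes_containing:
  assumes a: "a \<in> ints" "a \<noteq> 0"
  shows "finite {Q \<in> nonzero_primes K. a \<in> Q}"
proof -
  obtain d :: nat and e where d: "d > 0" "e \<in> ints" "a * e = of_nat d"
    using int_multiple_of_int[OF a] by blast
  obtain R where R: "R \<subseteq> ints" "finite R" "\<forall>y\<in>ints. \<exists>r\<in>R. \<exists>t\<in>ints. y = r + of_nat d * t"
    using finite_mod[OF d(1)] by blast
  have sub: "Q \<subseteq> Q'" if Q: "Q \<in> nonzero_primes K" "a \<in> Q" and Q': "Q' \<in> nonzero_primes K" "a \<in> Q'"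
    and eq: "Q \<inter> R = Q' \<inter> R" for Q Q'
  proof
    interpret Q: prime_loc K Q by unfold_locales (rule Q(1))
    interpret Q': prime_loc K Q' by unfold_locales (rule Q'(1))
    fix y assume y: "y \<in> Q"
    obtain r t where r: "r \<in> R" "t \<in> ints" "y = r + of_nat d * t"
      using R(3) Q.P_subset[OF y] by blast
    have "of_nat d * t \<in> Q"
      using Q.P_mult'[OF Q.P_mult'[OF Q(2) d(2)] r(2)] d(3) by simp
    then have "y - of_nat d * t \<in> Q" by (rule Q.P_diff[OF y])
    then have "r \<in> Q \<inter> R" using r(1,3) by simp
    then have "r \<in> Q'" using eq by blast
    moreover have "of_nat d * t \<in> Q'"
      using Q'.P_mult'[OF Q'.P_mult'[OF Q'(2) d(2)] r(2)] d(3) by simp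
    ultimately show "y \<in> Q'"
      unfolding r(3) by (rule Q'.P_add)
  qed
  have "inj_on (\<lambda>Q. Q \<inter> R) {Q \<in> nonzero_primes K. a \<in> Q}"
  proof (rule inj_onI)
    fix Q Q' assume "Q \<in> {Q \<in> nonzero_primes K. a \<in> Q}" "Q' \<in> {Q \<in> nonzero_primes K. a \<in> Q}"
      and eq: "Q \<inter> R = Q' \<inter> R"
    then have "Q \<in> nonzero_primes K" "a \<in> Q" "Q' \<in> nonzero_primes K" "a \<in> Q'"
      by simp_all
    from sub[OF this eq] sub[OF this(3,4,1,2) eq[symmetric]] show "Q = Q'"
      by (rule equalityI)
  qed
  moreover have "(\<lambda>Q. Q \<inter> R) ` {Q \<in> nonzero_primes K. a \<in> Q} \<subseteq> Pow R"
    by auto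
  ultimately show ?thesis
    using R(2) by (meson finite_Pow_iff inj_on_finite)
qed

lemma finite_primes_over: "Factorial_Ring.prime q \<Longrightarrow> finite {Q \<in> nonzero_primes K. lies_over Q q}"
proof (rule finite_subset[OF _ finite_primes_containing[OF ints_closed(8)[of q]]])
  show "{Q \<in> nonzero_primes K. lies_over Q q} \<subseteq> {Q \<in> nonzero_primes K. of_nat q \<in> Q}"
  proof (intro subsetI CollectI)
    fix Q assume Q: "Q \<in> {Q \<in> nonzero_primes K. lies_over Q q}"
    then have "lies_over Q q" by simp
    then have "of_int (int q) \<in> Q"
      by (simp only: lies_over_def dvd_refl)
    then show "Q \<in> nonzero_primes K \<and> of_nat q \<in> Q"
      using Q by simp
  qed
qed (use prime_gt_0_nat in force)

end

context prime_loc
begin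

section \<open>The normalised valuation at P\<close>

lemma ord_integer_1: "ord_integer K P 1 = 0"
  using ord_integer_eq_0_iff[OF ints_closed(2) one_neq_zero] P_one by blast

text \<open>Makes the description in \<open>ord_at\<close> unique: two fractions for the same
  element are compared by cross multiplication and additivity of \<open>ord_integer\<close>.\<close>

lemma ord_at_quotient:
  assumes a: "a \<in> ints" "a \<noteq> 0" and b: "b \<in> ints" "b \<noteq> 0"
  shows "ord_at K P (a / b) = int (ord_integer K P a) - int (ord_integer K P b)"
  unfolding ord_at_def
proof (rule the_equality)
  show "\<exists>a'\<in>carrier (\<O> K) - {0}. \<exists>b'\<in>carrier (\<O> K) - {0}. a / b = a' / b' \<and>
    int (ord_integer K P a) - int (ord_integer K P b) = int (ord_integer K P a') - int (ord_integer K P b')"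
    using a b by (intro bexI[of _ a] bexI[of _ b]) auto
next
  fix m
  assume "\<exists>a'\<in>carrier (\<O> K) - {0}. \<exists>b'\<in>carrier (\<O> K) - {0}. a / b = a' / b' \<and>
    m = int (ord_integer K P a') - int (ord_integer K P b')"
  then obtain a' b' where *: "a' \<in> ints" "a' \<noteq> 0" "b' \<in> ints" "b' \<noteq> 0" "a / b = a' / b'"
    "m = int (ord_integer K P a') - int (ord_integer K P b')"
    by auto
  then have "a * b' = a' * b"
    using b(2) by (simp add: frac_eq_eq)
  then have "ord_integer K P a + ord_integer K P b' = ord_integer K P a' + ord_integer K P b"
    using ord_integer_mult[OF a *(3,4)] ord_integer_mult[OF *(1,2) b] by simp
  then show "m = int (ord_integer K P a) - int (ord_integer K P b)"
    using *(6) by simp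
qed

lemma ord_at_mult:
  assumes x: "x \<in> K" "x \<noteq> 0" and y: "y \<in> K" "y \<noteq> 0"
  shows "ord_at K P (x * y) = ord_at K P x + ord_at K P y"
proof -
  obtain a b where ab: "a \<in> ints" "a \<noteq> 0" "b \<in> ints" "b \<noteq> 0" "x = a / b"
    by (rule quotient_of_integers[OF x])
  obtain c d where cd: "c \<in> ints" "c \<noteq> 0" "d \<in> ints" "d \<noteq> 0" "y = c / d"
    by (rule quotient_of_integers[OF y])
  have nz: "a * c \<noteq> 0" "b * d \<noteq> 0" using ab cd by auto
  have "x * y = (a * c) / (b * d)" using ab cd by simp
  then have "ord_at K P (x * y) = int (ord_integer K P (a * c)) - int (ord_integer K P (b * d))"
    using ord_at_quotient[OF ints_closed(4)[OF ab(1) cd(1)] nz(1) ints_closed(4)[OF ab(3) cd(3)] nz(2)]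
    by simp
  also have "\<dots> = ord_at K P x + ord_at K P y"
    unfolding ab(5) cd(5) ord_integer_mult[OF ab(1,2) cd(1,2)] ord_integer_mult[OF ab(3,4) cd(3,4)]
      ord_at_quotient[OF ab(1-4)] ord_at_quotient[OF cd(1-4)] by simp
  finally show ?thesis .
qed

lemma ord_at_integer: "a \<in> ints \<Longrightarrow> a \<noteq> 0 \<Longrightarrow> ord_at K P a = int (ord_integer K P a)"
  using ord_at_quotient[of a 1] ints_closed(2) ord_integer_1 by simp

lemma ord_at_eq_0: "a \<in> ints \<Longrightarrow> a \<noteq> 0 \<Longrightarrow> a \<notin> P \<Longrightarrow> ord_at K P a = 0"
  using ord_at_integer[of a] ord_integer_eq_0_iff[of a] by simp

lemma val_mult:
  "x \<in> K \<Longrightarrow> x \<noteq> 0 \<Longrightarrow> y \<in> K \<Longrightarrow> y \<noteq> 0 \<Longrightarrow> \<nu> K P (x * y) = \<nu> K P x + \<nu> K P y"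
  unfolding valuation_def by (simp add: ord_at_mult add_divide_distrib)

lemma val_eq_0: "a \<in> ints \<Longrightarrow> a \<noteq> 0 \<Longrightarrow> a \<notin> P \<Longrightarrow> \<nu> K P a = 0"
  unfolding valuation_def by (simp add: ord_at_eq_0)

lemma val_1: "\<nu> K P 1 = 0"
  using val_eq_0[OF ints_closed(2) _ P_one] by simp

lemma val_p0: "\<nu> K P (of_nat p0) = 1"
proof -
  have nz: "of_nat p0 \<noteq> (0::'a)"
    using prime_gt_0_nat[OF prime_p0] by simp
  have "ord_integer K P (of_nat p0) \<noteq> 0"
    using ord_integer_eq_0_iff[OF ints_closed(8) nz] p0_in_P by simp
  then have "ord_at K P (of_nat p0) \<noteq> 0"
    using ord_at_integer[OF ints_closed(8) nz] by simp
  then show ?thesis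
    unfolding valuation_def by simp
qed

lemma val_divide:
  assumes "x \<in> K" "x \<noteq> 0" "y \<in> K" "y \<noteq> 0"
  shows "\<nu> K P (x / y) = \<nu> K P x - \<nu> K P y"
  using val_mult[OF K_closed(8)[OF assms(1,3)] _ assms(3,4)] assms by simp

lemma val_power: "x \<in> K \<Longrightarrow> x \<noteq> 0 \<Longrightarrow> \<nu> K P (x ^ k) = of_nat k * \<nu> K P x"
proof (induction k)
  case 0
  then show ?case by (simp add: val_1)
next
  case (Suc k)
  then show ?case
    using val_mult[OF Suc.prems K_closed(9)[OF Suc.prems(1)], of k] by (simp add: algebra_simps)
qed

text \<open>Once the power of p0 is split off, the remaining integer lies outside P, and p0 itself
  has value 1 by the normalisation. All later estimates pass through this link to divisibility of
  integers.\<close>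

lemma val_of_int:
  assumes "m \<noteq> 0"
  shows "\<nu> K P (of_int m) = of_nat (multiplicity (int p0) m)"
proof -
  have "\<not> is_unit (int p0)"
    using prime_gt_1_nat[OF prime_p0] by auto
  then obtain k where k: "m = int p0 ^ multiplicity (int p0) m * k" "\<not> int p0 dvd k"
    using multiplicity_decompose'[OF assms] by blast
  have nz: "of_nat p0 \<noteq> (0::'a)" "of_int k \<noteq> (0::'a)"
    using prime_gt_0_nat[OF prime_p0] k assms by auto
  have eq: "of_int m = (of_nat p0 ^ multiplicity (int p0) m * of_int k :: 'a)"
    by (subst k(1)) simp
  have "\<nu> K P (of_int k) = 0"
    using k(2) by (intro val_eq_0 ints_closed(9) nz) (simp add: of_int_in_P_iff)
  then show ?thesis
    unfolding eq using val_mult[OF K_closed(9)[OF K_closed(10)] _ K_closed(11) nz(2), of p0 "multiplicity (int p0) m"]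
    using nz(1) val_power[OF K_closed(10) nz(1)] val_p0 by simp
qed

lemma val_of_nat: "m > 0 \<Longrightarrow> \<nu> K P (of_nat m) = of_nat (multiplicity (int p0) (int m))"
  using val_of_int[of "int m"] by simp

text \<open>The multiplier g again: the elements z of O_L with g z integral form an ideal
  \<open>I\<close> containing P, and it is proper because g is no more integral in L than in K. A
  maximal ideal above \<open>I\<close> meets O_K in a proper ideal containing P, hence in P.\<close>

lemma lying_over:
  assumes L: "number_field L" "K \<subseteq> L"
  obtains Q where "Q \<in> nonzero_primes L" "Q \<inter> carrier (\<O> K) = P"
proof -
  interpret L: number_field_loc L by unfold_locales (rule L(1))
  obtain g where g: "g \<in> K" "g \<notin> ints" "\<And>x. x \<in> P \<Longrightarrow> g * x \<in> ints"
    using exists_nonintegral_multiplier by blast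
  have ints_L: "x \<in> L.ints" if "x \<in> ints" for x using that L(2) by blast
  have gL: "g \<in> L" "g \<notin> L.ints" using g L(2) by auto
  define I where "I = {z \<in> L.ints. g * z \<in> L.ints}"
  have P_I: "x \<in> I" if "x \<in> P" for x
    using ints_L[OF P_subset[OF that]] ints_L[OF g(3)[OF that]] by (simp add: I_def)
  interpret R: cring "\<O> L" by (rule L.cring_O)
  have minus: "\<ominus>\<^bsub>\<O> L\<^esub> x = - x" if "x \<in> L.ints" for x
  proof -
    have "x + \<ominus>\<^bsub>\<O> L\<^esub> x = 0"
      using R.r_neg[of x] that by simp
    then show ?thesis by (metis add.inverse_unique)
  qed
  have I_add: "x + y \<in> I" if "x \<in> I" "y \<in> I" for x y
  proof -
    have "x \<in> L.ints" "y \<in> L.ints" "g * x \<in> L.ints" "g * y \<in> L.ints"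
      using that by (auto simp: I_def)
    from L.ints_closed(3)[OF this(1,2)] L.ints_closed(3)[OF this(3,4)] show ?thesis
      unfolding I_def by (simp add: distrib_left)
  qed
  have I_mult: "y * x \<in> I" if "x \<in> I" and y: "y \<in> L.ints" for x y
  proof -
    have x: "x \<in> L.ints" "g * x \<in> L.ints"
      using that by (auto simp: I_def)
    from L.ints_closed(4)[OF y x(1)] L.ints_closed(4)[OF y x(2)] show ?thesis
      unfolding I_def by (simp add: mult.left_commute)
  qed
  have ideal_I: "ideal I (\<O> L)"
  proof (rule idealI)
    show "ring (\<O> L)" by (rule R.ring_axioms)
    have I_sub: "I \<subseteq> L.ints" by (auto simp: I_def)
    show "subgroup I (add_monoid (\<O> L))"
    proof (rule R.add.subgroupI)
      show "I \<subseteq> carrier (\<O> L)" using I_sub by simp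
      show "I \<noteq> {}" using P_I[OF P_zero] by blast
      show "\<ominus>\<^bsub>\<O> L\<^esub> x \<in> I" if "x \<in> I" for x
      proof -
        have "x \<in> L.ints" using I_sub that by blast
        then show ?thesis
          using I_mult[OF that L.ints_closed(5)[OF L.ints_closed(2)]] minus by simp
      qed
      show "x \<oplus>\<^bsub>\<O> L\<^esub> y \<in> I" if "x \<in> I" "y \<in> I" for x y
        using I_add[OF that] by simp
    qed
    show "x \<otimes>\<^bsub>\<O> L\<^esub> a \<in> I" if "a \<in> I" "x \<in> carrier (\<O> L)" for a x
      using I_mult[of a x] that by simp
    show "a \<otimes>\<^bsub>\<O> L\<^esub> x \<in> I" if "a \<in> I" "x \<in> carrier (\<O> L)" for a x
      using I_mult[of a x] that by (simp add: mult.commute)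
  qed
  have one_I: "1 \<notin> I"
    using gL by (auto simp: I_def)
  obtain S where S: "S \<subseteq> L.ints" "finite S" "\<forall>y\<in>L.ints. \<exists>r\<in>S. \<exists>t\<in>L.ints. y = r + of_nat p0 * t"
    using L.finite_mod_prime[OF prime_p0] by blast
  \<comment> \<open>Every member contains p0, so it is a union of classes modulo p0 and is
    determined by its trace on S. A trace of maximal cardinality thus yields a maximal ideal by
    counting.\<close>
  define \<J> where "\<J> = {J. ideal J (\<O> L) \<and> I \<subseteq> J \<and> 1 \<notin> J}"
  have "I \<in> \<J>" using ideal_I one_I by (simp add: \<J>_def)
  moreover have bound: "card (J \<inter> S) < Suc (card S)" for J
    using S(2) by (simp add: card_mono less_Suc_eq_le)
  ultimately have "\<exists>Q. Q \<in> \<J> \<and> (\<forall>J. J \<in> \<J> \<longrightarrow> card (J \<inter> S) \<le> card (Q \<inter> S))"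
    using ex_has_greatest_nat[of "\<lambda>J. J \<in> \<J>" I "\<lambda>J. card (J \<inter> S)" "Suc (card S)"] by blast
  then obtain Q where Q: "Q \<in> \<J>" and Qmax: "\<And>J. J \<in> \<J> \<Longrightarrow> card (J \<inter> S) \<le> card (Q \<inter> S)"
    by blast
  have idQ: "ideal Q (\<O> L)" and IQ: "I \<subseteq> Q" and oneQ: "1 \<notin> Q"
    using Q by (auto simp: \<J>_def)
  have "maximalideal Q (\<O> L)"
  proof (rule maximalidealI[OF idQ])
    show "carrier (\<O> L) \<noteq> Q"
      using oneQ L.ints_closed(2) by auto
    fix J assume J: "ideal J (\<O> L)" "Q \<subseteq> J" "J \<subseteq> carrier (\<O> L)"
    show "J = Q \<or> J = carrier (\<O> L)"
    proof (cases "1 \<in> J")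
      case True
      have "x \<in> J" if "x \<in> carrier (\<O> L)" for x
        using ideal.I_l_closed[OF J(1) True that] by simp
      then show ?thesis using J(3) by blast
    next
      case False
      then have "J \<in> \<J>" using J IQ by (auto simp: \<J>_def)
      then have "Q \<inter> S = J \<inter> S"
        using Qmax S(2) J(2) by (intro card_seteq) auto
      have "J \<subseteq> Q"
      proof
        fix y assume y: "y \<in> J"
        then obtain r t where r: "r \<in> S" "t \<in> L.ints" "y = r + of_nat p0 * t"
          using S(3) J(3) by auto
        have pQ: "of_nat p0 * t \<in> Q"
          using ideal.I_r_closed[OF idQ, of "of_nat p0" t] P_I[OF p0_in_P] IQ r(2) by auto
        have "y + (- 1) * (of_nat p0 * t) \<in> J"
          using additive_subgroup.a_closed[OF ideal.axioms(1)[OF J(1)] y, of "(- 1) * (of_nat p0 * t)"]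
            ideal.I_l_closed[OF J(1), of "of_nat p0 * t" "- 1"] pQ J(2)
            L.ints_closed(5)[OF L.ints_closed(2)] by auto
        then have "r \<in> J \<inter> S" using r(1,3) by simp
        then have "r \<in> Q" using \<open>Q \<inter> S = J \<inter> S\<close> by blast
        then show "y \<in> Q"
          using additive_subgroup.a_closed[OF ideal.axioms(1)[OF idQ] _ pQ] r(3) by simp
      qed
      then show ?thesis using J(2) by blast
    qed
  qed
  then have primeQ: "primeideal Q (\<O> L)"
    by (rule R.maximalideal_prime)
  have PQ: "x \<in> Q" if "x \<in> P" for x using P_I[OF that] IQ by blast
  have "Q \<noteq> {0}"
    using PQ[OF p0_in_P] prime_gt_0_nat[OF prime_p0] by auto
  then have Qp: "Q \<in> nonzero_primes L"
    using primeQ by (simp add: nonzero_primes_def)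
  interpret Q: prime_loc L Q by unfold_locales (rule Qp)
  have "Q \<inter> carrier (\<O> K) = P"
  proof
    show "P \<subseteq> Q \<inter> carrier (\<O> K)" using PQ P_subset by auto
    show "Q \<inter> carrier (\<O> K) \<subseteq> P"
    proof
      fix x assume x: "x \<in> Q \<inter> carrier (\<O> K)"
      then have xi: "x \<in> ints" by simp
      show "x \<in> P"
      proof (rule ccontr)
        assume "x \<notin> P"
        then obtain e where e: "e \<in> ints" "1 - e * x \<in> P"
          by (rule P_maximal[OF xi])
        have "(1 - e * x) + e * x \<in> Q"
          using x by (intro Q.P_add PQ[OF e(2)] Q.P_mult ints_L[OF e(1)]) auto
        then show False using oneQ by simp
      qed
    qed
  qed
  then show ?thesis using that Qp by blast
qed

end

section \<open>Extension of field embeddings\<close>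

definition coeffs_in :: "'a::field_char_0 set \<Rightarrow> 'a Polynomial.poly \<Rightarrow> bool"
  where "coeffs_in F q \<longleftrightarrow> (\<forall>i. Polynomial.coeff q i \<in> F)"

text \<open>Embeddings are total functions constrained only on F, so extending one along F
  \<subseteq> E just means agreement on F. The condition at 1 excludes the zero map.\<close>

definition partial_hom :: "'a::field_char_0 set \<Rightarrow> ('a \<Rightarrow> 'a) \<Rightarrow> bool"
  where "partial_hom F \<sigma> \<longleftrightarrow> subfield F ambient \<and> \<sigma> 1 = 1 \<and>
    (\<forall>x\<in>F. \<forall>y\<in>F. \<sigma> (x + y) = \<sigma> x + \<sigma> y \<and> \<sigma> (x * y) = \<sigma> x * \<sigma> y)"

lemma coeffs_in_pCons:
  assumes "subfield F ambient"
  shows "coeffs_in F (pCons a q) \<longleftrightarrow> a \<in> F \<and> coeffs_in F q"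
proof -
  have "(\<forall>i. Polynomial.coeff (pCons a q) i \<in> F) \<longleftrightarrow> a \<in> F \<and> (\<forall>i. Polynomial.coeff q i \<in> F)"
    by (metis coeff_pCons_0 coeff_pCons_Suc not0_implies_Suc)
  then show ?thesis by (simp add: coeffs_in_def)
qed

lemma
  assumes F: "subfield F ambient" and p: "coeffs_in F p" and q: "coeffs_in F q"
  shows coeffs_in_add: "coeffs_in F (p + q)" and coeffs_in_diff: "coeffs_in F (p - q)"
    and coeffs_in_mult: "coeffs_in F (p * q)"
  using p q subfield_closed(3,6)[OF F]
  by (auto simp: coeffs_in_def coeff_mult intro!: subfield_closed(13)[OF F] subfield_closed(4)[OF F])

lemma partial_hom_props:
  assumes "partial_hom F \<sigma>"
  shows "subfield F ambient" "\<sigma> 1 = 1" "\<sigma> 0 = 0" "x \<in> F \<Longrightarrow> y \<in> F \<Longrightarrow> \<sigma> (x + y) = \<sigma> x + \<sigma> y"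
    "x \<in> F \<Longrightarrow> y \<in> F \<Longrightarrow> \<sigma> (x * y) = \<sigma> x * \<sigma> y" "x \<in> F \<Longrightarrow> \<sigma> (- x) = - \<sigma> x"
    "\<sigma> (of_int m) = of_int m" "\<sigma> (of_rat r) = of_rat r"
    "(\<And>i. i \<in> I \<Longrightarrow> f i \<in> F) \<Longrightarrow> \<sigma> (sum f I) = (\<Sum>i\<in>I. \<sigma> (f i))"
proof -
  show F: "subfield F ambient" and one: "\<sigma> 1 = 1"
    and add: "x \<in> F \<Longrightarrow> y \<in> F \<Longrightarrow> \<sigma> (x + y) = \<sigma> x + \<sigma> y"
    and mult: "x \<in> F \<Longrightarrow> y \<in> F \<Longrightarrow> \<sigma> (x * y) = \<sigma> x * \<sigma> y" for x y
    using assms by (auto simp: partial_hom_def)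
  note cl = subfield_closed[OF F]
  show zero: "\<sigma> 0 = 0"
    using add[OF cl(2) cl(2)] by simp
  show minus: "x \<in> F \<Longrightarrow> \<sigma> (- x) = - \<sigma> x" for x
    using add[OF cl(5), of x x] zero by (simp add: eq_neg_iff_add_eq_0)
  have nat: "\<sigma> (of_nat k) = of_nat k" for k
  proof (induction k)
    case (Suc k)
    then show ?case using add[OF cl(1) cl(10), of k] one by simp
  qed (simp add: zero)
  show int: "\<sigma> (of_int m) = of_int m" for m
  proof (cases m)
    case (nonneg n)
    then show ?thesis using nat by simp
  next
    case (neg n)
    then show ?thesis using nat[of "Suc n"] minus[OF cl(10), of "Suc n"] by (simp del: of_nat_Suc)
  qed
  show "\<sigma> (of_rat r) = of_rat r"
  proof (cases r)
    case (Fract a b)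
    have b: "of_int b \<noteq> (0::'a)" using Fract(2) by simp
    have r: "of_rat r = (of_int a / of_int b :: 'a)"
      using Fract by (simp add: of_rat_rat)
    have rb: "of_rat r * of_int b = (of_int a :: 'a)"
      using r b by simp
    have "\<sigma> (of_rat r) * of_int b = of_rat r * of_int b"
      using mult[OF cl(12) cl(11), of r b] unfolding rb int by simp
    then show ?thesis
      by (rule mult_right_cancel[OF b, THEN iffD1])
  qed
  show "(\<And>i. i \<in> I \<Longrightarrow> f i \<in> F) \<Longrightarrow> \<sigma> (sum f I) = (\<Sum>i\<in>I. \<sigma> (f i))"
  proof (induction I rule: infinite_finite_induct)
    case (insert i I)
    have "\<sigma> (f i + sum f I) = \<sigma> (f i) + \<sigma> (sum f I)"
      using insert.prems by (intro add cl(13)) auto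
    then show ?case using insert by simp
  qed (simp_all add: zero)
qed

lemma
  assumes h: "partial_hom F \<sigma>" and p: "coeffs_in F p" and q: "coeffs_in F q"
  shows map_poly_partial_add: "map_poly \<sigma> (p + q) = map_poly \<sigma> p + map_poly \<sigma> q"
    and map_poly_partial_mult: "map_poly \<sigma> (p * q) = map_poly \<sigma> p * map_poly \<sigma> q"
proof -
  note H = partial_hom_props[OF h]
  have pq: "Polynomial.coeff p i \<in> F" "Polynomial.coeff q i \<in> F" for i
    using p q by (auto simp: coeffs_in_def)
  show "map_poly \<sigma> (p + q) = map_poly \<sigma> p + map_poly \<sigma> q"
    by (rule poly_eqI) (simp add: coeff_map_poly H(3) H(4)[OF pq])
  show "map_poly \<sigma> (p * q) = map_poly \<sigma> p * map_poly \<sigma> q"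
  proof (rule poly_eqI)
    fix n
    have "\<sigma> (\<Sum>i\<le>n. Polynomial.coeff p i * Polynomial.coeff q (n - i)) =
        (\<Sum>i\<le>n. \<sigma> (Polynomial.coeff p i * Polynomial.coeff q (n - i)))"
      by (intro H(9) subfield_closed(4)[OF H(1)] pq)
    also have "\<dots> = (\<Sum>i\<le>n. \<sigma> (Polynomial.coeff p i) * \<sigma> (Polynomial.coeff q (n - i)))"
      by (intro sum.cong refl H(5) pq)
    finally show "Polynomial.coeff (map_poly \<sigma> (p * q)) n = Polynomial.coeff (map_poly \<sigma> p * map_poly \<sigma> q) n"
      by (simp add: coeff_map_poly H(3) coeff_mult)
  qed
qed

text \<open>Long division by a monic polynomial never leaves F; division of polynomials over the
  whole ambient type would lose track of the coefficient field.\<close>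

lemma coeffs_in_division:
  assumes F: "subfield F ambient" and m: "coeffs_in F m" "Polynomial.lead_coeff m = 1"
    and "coeffs_in F p"
  shows "\<exists>s r. coeffs_in F s \<and> coeffs_in F r \<and> p = m * s + r \<and> (r = 0 \<or> Polynomial.degree r < Polynomial.degree m)"
  using assms(4)
proof (induction "Polynomial.degree p" arbitrary: p rule: less_induct)
  case less
  have zero: "coeffs_in F 0" using subfield_closed(2)[OF F] by (simp add: coeffs_in_def)
  show ?case
  proof (cases "p = 0 \<or> Polynomial.degree p < Polynomial.degree m")
    case True
    then show ?thesis
      using less.prems zero by (intro exI[of _ 0] exI[of _ p]) auto
  next
    case False
    define k where "k = Polynomial.degree p - Polynomial.degree m"
    define a where "a = Polynomial.monom (Polynomial.lead_coeff p) k"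
    have a: "coeffs_in F a"
      using less.prems subfield_closed(2)[OF F] by (auto simp: coeffs_in_def a_def coeff_monom)
    define p' where "p' = p - m * a"
    have p': "coeffs_in F p'"
      unfolding p'_def by (intro coeffs_in_diff coeffs_in_mult F m a less.prems)
    have m0: "m \<noteq> 0" using m(2) by auto
    have lp: "Polynomial.lead_coeff p \<noteq> 0" using False by auto
    have deg1: "Polynomial.degree (m * a) = Polynomial.degree p"
      using False lp m0 by (auto simp: a_def k_def degree_mult_eq degree_monom_eq)
    have "Polynomial.lead_coeff (m * a) = Polynomial.lead_coeff p"
      unfolding lead_coeff_mult m(2) using lp by (simp add: a_def degree_monom_eq)
    note deg = deg1 this
    show ?thesis
    proof (cases "p' = 0")
      case True
      then show ?thesis
        using a zero by (intro exI[of _ a] exI[of _ 0]) (auto simp: p'_def)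
    next
      case False
      have "Polynomial.degree p' \<le> Polynomial.degree p"
        unfolding p'_def using degree_diff_le[of p "Polynomial.degree p" "m * a"] deg(1) by simp
      moreover have "Polynomial.coeff p' (Polynomial.degree p) = 0"
        unfolding p'_def using deg by simp
      ultimately have "Polynomial.degree p' < Polynomial.degree p"
        using False by (metis le_neq_implies_less leading_coeff_0_iff)
      then obtain s r where sr: "coeffs_in F s" "coeffs_in F r" "p' = m * s + r"
        "r = 0 \<or> Polynomial.degree r < Polynomial.degree m"
        using less.hyps[OF _ p'] by blast
      have "p = m * (s + a) + r"
        using sr(3) by (simp add: p'_def algebra_simps)
      then show ?thesis
        using sr(2,4) coeffs_in_add[OF F sr(1) a] by blast
    qed
  qed
qed

text \<open>Any root of the image under \<open>\<sigma>\<close> of the minimal polynomial \<open>m\<close> of \<open>c\<close> over \<open>F\<close> can serve as \<open>d\<close>.\<close>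

lemma exists_conjugate:
  fixes F :: "'a :: {alg_closed_field, field_char_0} set"
  assumes h: "partial_hom F \<sigma>" and q: "coeffs_in F q" "q \<noteq> 0" "poly q c = 0"
  shows "\<exists>d. \<forall>q. coeffs_in F q \<longrightarrow> poly q c = 0 \<longrightarrow> poly (map_poly \<sigma> q) d = 0"
proof -
  note H = partial_hom_props[OF h]
  define A where "A = (\<lambda>q. coeffs_in F q \<and> q \<noteq> 0 \<and> poly q c = 0)"
  have "\<exists>m. A m \<and> (\<forall>q. A q \<longrightarrow> Polynomial.degree m \<le> Polynomial.degree q)"
    using ex_has_least_nat[of A q Polynomial.degree] q by (simp add: A_def)
  then obtain m0 where m0: "A m0" "\<And>q. A q \<Longrightarrow> Polynomial.degree m0 \<le> Polynomial.degree q"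
    by blast
  define l where "l = inverse (Polynomial.lead_coeff m0)"
  define m where "m = Polynomial.smult l m0"
  have l0: "l \<noteq> 0" using m0(1) by (simp add: l_def A_def)
  have lF: "l \<in> F"
    using m0(1) subfield_closed(7)[OF H(1)] by (auto simp: l_def A_def coeffs_in_def)
  have m: "coeffs_in F m" "Polynomial.lead_coeff m = 1" "poly m c = 0" "Polynomial.degree m = Polynomial.degree m0"
    using m0(1) l0 lF subfield_closed(4)[OF H(1)] by (auto simp: m_def A_def coeffs_in_def l_def)
  have "Polynomial.degree m > 0"
  proof (rule ccontr)
    assume "\<not> Polynomial.degree m > 0"
    then obtain a where "m = [:a:]" by (auto elim: degree_eq_zeroE)
    then show False using m by auto
  qed
  \<comment> \<open>The leading coefficient 1 is fixed by \<sigma>, so the image is again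
    nonconstant and has a root in the algebraically closed ambient field.\<close>
  moreover have "Polynomial.degree (map_poly \<sigma> m) = Polynomial.degree m"
    using m(2) H(2,3) by (intro antisym[OF degree_le le_degree]) (auto simp: coeff_map_poly coeff_eq_0)
  ultimately obtain d where d: "poly (map_poly \<sigma> m) d = 0"
    using alg_closed_imp_poly_has_root[of "map_poly \<sigma> m"] by auto
  have "poly (map_poly \<sigma> q) d = 0" if q: "coeffs_in F q" "poly q c = 0" for q
  proof -
    obtain s r where sr: "coeffs_in F s" "coeffs_in F r" "q = m * s + r"
      "r = 0 \<or> Polynomial.degree r < Polynomial.degree m"
      using coeffs_in_division[OF H(1) m(1,2) q(1)] by blast
    have "poly r c = 0" using sr(3) q(2) m(3) by simp
    then have "r = 0"
      using m0(2)[of r] sr(2,4) m(4) unfolding A_def by fastforce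
    then have "map_poly \<sigma> q = map_poly \<sigma> m * map_poly \<sigma> s"
      using sr(3) map_poly_partial_mult[OF h m(1) sr(1)] by simp
    then show ?thesis using d by simp
  qed
  then show ?thesis by blast
qed

section \<open>Extending an embedding to finitely many algebraic elements\<close>

lemma simple_extension_ambient:
  fixes F :: "'a :: field_char_0 set"
  assumes F: "subfield F ambient"
  shows "ring.simple_extension ambient F c = {poly q c | q. coeffs_in F q}"
proof -
  interpret R: field "ambient :: 'a ring" by (rule field_from_type_algebra)
  show ?thesis
  proof (intro equalityI subsetI)
    fix z assume "z \<in> R.simple_extension F c"
    then show "z \<in> {poly q c | q. coeffs_in F q}"
    proof (induction rule: R.simple_extension.induct)
      case zero
      show ?case using subfield_closed(2)[OF F] by (auto simp: coeffs_in_def intro!: exI[of _ 0])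
    next
      case (lin k1 k2)
      then obtain q where q: "k1 = poly q c" "coeffs_in F q" by blast
      have "k1 \<otimes>\<^bsub>ambient\<^esub> c \<oplus>\<^bsub>ambient\<^esub> k2 = poly (pCons k2 q) c"
        using q(1) by (simp add: mult.commute)
      moreover have "coeffs_in F (pCons k2 q)"
        using coeffs_in_pCons[OF F] q(2) lin by blast
      ultimately show ?case by blast
    qed
  next
    fix z assume "z \<in> {poly q c | q. coeffs_in F q}"
    then obtain q where "z = poly q c" "coeffs_in F q" by blast
    moreover have "coeffs_in F q \<Longrightarrow> poly q c \<in> R.simple_extension F c" for q
    proof (induction q)
      case 0
      show ?case using R.simple_extension.zero[of F c] by simp
    next
      case (pCons a q)
      then have "a \<in> F" "poly q c \<in> R.simple_extension F c"
        using coeffs_in_pCons[OF F] by auto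
      then show ?case
        using R.simple_extension.lin[of "poly q c" F c a] by (simp add: add.commute mult.commute)
    qed
    ultimately show "z \<in> R.simple_extension F c" by blast
  qed
qed

lemma algebraic_over_ambient:
  fixes F :: "'a :: field_char_0 set"
  assumes F: "subfield F ambient" and q: "coeffs_in F q" "q \<noteq> 0" "poly q c = 0"
  shows "\<not> ring.transcendental ambient F c"
proof -
  interpret R: field "ambient :: 'a ring" by (rule field_from_type_algebra)
  \<comment> \<open>Polynomials as lists start with the leading coefficient, \<open>coeffs\<close>
    with the constant one.\<close>
  have ev: "R.eval (rev (Polynomial.coeffs q)) c = poly q c" for q
  proof (induction q)
    case (pCons a q)
    then show ?case
      using R.eval_append_aux[of "rev (Polynomial.coeffs q)" a c] by (simp add: cCons_def add.commute mult.commute)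
  qed simp
  define p where "p = rev (Polynomial.coeffs q)"
  have "set p \<subseteq> F"
    using q(1) by (auto simp: p_def coeffs_in_def coeffs_def)
  moreover have "p \<noteq> []" "hd p \<noteq> 0"
    using q(2) by (auto simp: p_def hd_rev last_coeffs_eq_coeff_degree)
  ultimately have "p \<in> carrier (univ_poly ambient F)"
    by (simp add: univ_poly_def polynomial_def)
  then show ?thesis
    using R.algebraicI[of p F c] \<open>p \<noteq> []\<close> ev[of q] q(3) by (simp add: p_def over_def)
qed

text \<open>The assumption on d says that sending q(c) to (\<sigma> q)(d) is well defined, since two
  polynomials with equal values at c differ by one that vanishes there.\<close>

lemma partial_hom_extend:
  fixes F :: "'a :: field_char_0 set"
  assumes h: "partial_hom F \<sigma>" and q: "coeffs_in F q" "q \<noteq> 0" "poly q c = 0"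
    and d: "\<And>q. coeffs_in F q \<Longrightarrow> poly q c = 0 \<Longrightarrow> poly (map_poly \<sigma> q) d = 0"
  shows "\<exists>\<tau>. partial_hom (ring.simple_extension ambient F c) \<tau> \<and> (\<forall>x\<in>F. \<tau> x = \<sigma> x) \<and> \<tau> c = d"
proof -
  interpret R: field "ambient :: 'a ring" by (rule field_from_type_algebra)
  note H = partial_hom_props[OF h]
  define E where "E = R.simple_extension F c"
  have E: "E = {poly q c | q. coeffs_in F q}"
    unfolding E_def by (rule simple_extension_ambient[OF H(1)])
  have sub: "subfield E ambient"
    using R.simple_extension_is_subfield[OF H(1), of c] algebraic_over_ambient[OF H(1) q]
    by (simp add: E_def over_def)
  have wd: "poly (map_poly \<sigma> p) d = poly (map_poly \<sigma> q) d"
    if "coeffs_in F p" "coeffs_in F q" "poly p c = poly q c" for p q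
  proof -
    have "coeffs_in F (p - q)" by (rule coeffs_in_diff[OF H(1) that(1,2)])
    then have "poly (map_poly \<sigma> (p - q)) d = 0"
      using d that(3) by simp
    moreover have "map_poly \<sigma> p = map_poly \<sigma> (p - q) + map_poly \<sigma> q"
      using map_poly_partial_add[OF h \<open>coeffs_in F (p - q)\<close> that(2)] by simp
    ultimately show ?thesis by simp
  qed
  define \<tau> where "\<tau> = (\<lambda>z. poly (map_poly \<sigma> (SOME q. coeffs_in F q \<and> poly q c = z)) d)"
  have tau: "\<tau> (poly q c) = poly (map_poly \<sigma> q) d" if "coeffs_in F q" for q
  proof -
    have "coeffs_in F (SOME p. coeffs_in F p \<and> poly p c = poly q c) \<and>
      poly (SOME p. coeffs_in F p \<and> poly p c = poly q c) c = poly q c"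
      by (rule someI[of _ q]) (use that in simp)
    then show ?thesis
      unfolding \<tau>_def using wd that by blast
  qed
  have const: "coeffs_in F [:a:]" if "a \<in> F" for a
    using that subfield_closed(2)[OF H(1)] by (auto simp: coeffs_in_def coeff_pCons split: nat.splits)
  have fix_F: "\<tau> x = \<sigma> x" if "x \<in> F" for x
    using tau[OF const[OF that]] H(3) by (simp add: Polynomial.map_poly_pCons)
  have X: "coeffs_in F [:0, 1:]"
    using subfield_closed(1,2)[OF H(1)] by (auto simp: coeffs_in_def coeff_pCons split: nat.splits)
  have "\<tau> c = d"
    using tau[OF X] H(2,3) by (simp add: Polynomial.map_poly_pCons)
  moreover have "partial_hom E \<tau>"
    unfolding partial_hom_def
  proof (intro conjI ballI)
    show "\<tau> 1 = 1" using fix_F[OF subfield_closed(1)[OF H(1)]] H(2) by simp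
    fix x y assume "x \<in> E" "y \<in> E"
    then obtain p q where pq: "x = poly p c" "coeffs_in F p" "y = poly q c" "coeffs_in F q"
      unfolding E by blast
    show "\<tau> (x + y) = \<tau> x + \<tau> y"
      using tau[OF coeffs_in_add[OF H(1) pq(2,4)]] tau[OF pq(2)] tau[OF pq(4)] pq
        map_poly_partial_add[OF h pq(2,4)] by simp
    show "\<tau> (x * y) = \<tau> x * \<tau> y"
      using tau[OF coeffs_in_mult[OF H(1) pq(2,4)]] tau[OF pq(2)] tau[OF pq(4)] pq
        map_poly_partial_mult[OF h pq(2,4)] by simp
  qed (rule sub)
  ultimately show ?thesis
    using fix_F unfolding E_def by blast
qed

text \<open>Elements algebraic over the rationals remain algebraic over each intermediate field, so
  they are adjoined one at a time, each sent to a conjugate.\<close>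

lemma partial_hom_extend_finite:
  fixes F :: "'a :: {alg_closed_field, field_char_0} set"
  assumes h: "partial_hom F \<sigma>"
    and xs: "\<And>x. x \<in> set xs \<Longrightarrow> \<exists>q. coeffs_in \<rat> q \<and> q \<noteq> 0 \<and> poly q x = 0"
  shows "\<exists>\<tau>. partial_hom (ring.finite_extension ambient F xs) \<tau> \<and> (\<forall>x\<in>F. \<tau> x = \<sigma> x) \<and>
    F \<subseteq> ring.finite_extension ambient F xs"
proof -
  interpret R: field "ambient :: 'a ring" by (rule field_from_type_algebra)
  show ?thesis
    using xs
  proof (induction xs)
    case Nil
    then show ?case using h by auto
  next
    case (Cons x xs)
    define E where "E = R.finite_extension F xs"
    obtain \<tau> where tau: "partial_hom E \<tau>" "\<forall>x\<in>F. \<tau> x = \<sigma> x" "F \<subseteq> E"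
      using Cons unfolding E_def by auto
    obtain q where q: "coeffs_in \<rat> q" "q \<noteq> 0" "poly q x = 0"
      using Cons.prems[of x] by auto
    have E: "subfield E ambient" by (rule partial_hom_props(1)[OF tau(1)])
    have qE: "coeffs_in E q"
      using q(1) subfield_closed(12)[OF E] unfolding coeffs_in_def by (metis Rats_cases)
    obtain d where "\<forall>q. coeffs_in E q \<longrightarrow> poly q x = 0 \<longrightarrow> poly (map_poly \<tau> q) d = 0"
      using exists_conjugate[OF tau(1) qE q(2,3)] by blast
    then obtain \<tau>' where "partial_hom (R.simple_extension E x) \<tau>'" "\<forall>x\<in>E. \<tau>' x = \<tau> x"
      using partial_hom_extend[OF tau(1) qE q(2,3), of d] by blast
    moreover have "R.finite_extension F (x # xs) = R.simple_extension E x"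
      by (simp add: E_def)
    moreover have "E \<subseteq> R.simple_extension E x"
      by (rule R.simple_extension_incl) auto
    ultimately show ?case
      using tau(2,3) by (intro exI[of _ \<tau>']) auto
  qed
qed

lemma partial_hom_int_poly:
  assumes h: "partial_hom F \<sigma>" and x: "x \<in> F"
  shows "\<sigma> (poly (map_poly of_int q) x) = poly (map_poly of_int q) (\<sigma> x)"
proof -
  note H = partial_hom_props[OF h]
  note cl = subfield_closed[OF H(1)]
  have "poly (map_poly of_int q) x \<in> F \<and> \<sigma> (poly (map_poly of_int q) x) = poly (map_poly of_int q) (\<sigma> x)"
  proof (induction q)
    case 0
    then show ?case using cl(2) H(3) by simp
  next
    case (pCons a q)
    define z where "z = poly (map_poly of_int q) x"
    have z: "z \<in> F" "\<sigma> z = poly (map_poly of_int q) (\<sigma> x)"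
      using pCons by (auto simp: z_def)
    have eq: "poly (map_poly of_int (pCons a q)) x = of_int a + x * z"
      by (simp add: Polynomial.map_poly_pCons z_def)
    have "of_int a + x * z \<in> F"
      by (intro cl(3) cl(4) cl(11) x z)
    moreover have "\<sigma> (of_int a + x * z) = of_int a + \<sigma> x * \<sigma> z"
      using H(4)[OF cl(11) cl(4)[OF x z(1)]] H(5)[OF x z(1)] H(7) by simp
    ultimately show ?case
      unfolding eq by (simp add: Polynomial.map_poly_pCons z(2))
  qed
  then show ?thesis ..
qed

section \<open>Galois closure\<close>

lemma irreducible_bezout:
  fixes f q :: "rat Polynomial.poly"
  assumes "Factorial_Ring.irreducible f" "\<not> f dvd q"
  obtains u v where "u * f + v * q = 1"
proof -
  have "prime_elem f" using assms(1) by (rule irreducible_imp_prime_elem)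
  then have "gcd f q = 1"
    using assms(2) prime_elem_imp_coprime coprime_imp_gcd_eq_1 by blast
  then show ?thesis
    using that bezout_coefficients_fst_snd[of f q] by metis
qed

lemma of_rat_poly_hom: "map_poly_comm_ring_hom (of_rat :: rat \<Rightarrow> 'a :: field_char_0)"
  by unfold_locales (auto simp: of_rat_add of_rat_mult)

lemma coeffs_in_Rats:
  assumes "coeffs_in \<rat> (q :: 'a :: field_char_0 Polynomial.poly)"
  obtains q0 where "q = map_poly of_rat q0"
proof -
  have "\<forall>x\<in>\<rat>. \<exists>r. (x :: 'a) = of_rat r" by (meson Rats_cases)
  then obtain g where g: "\<And>x. x \<in> \<rat> \<Longrightarrow> (x :: 'a) = of_rat (g x)" by metis
  have g0: "g 0 = 0" using g[of 0] by simp
  have "q = map_poly of_rat (map_poly g q)"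
    using assms g by (intro poly_eqI) (simp add: coeff_map_poly g0 coeffs_in_def)
  then show ?thesis using that by blast
qed

text \<open>By Bezout, f divides every rational polynomial vanishing at y. This supplies the
  condition under which y \<mapsto> y' defines an embedding of the field generated by y.\<close>

lemma irreducible_common_root:
  fixes y y' :: "'a :: field_char_0"
  assumes f: "Factorial_Ring.irreducible f" "poly (map_poly of_rat f) y = 0" "poly (map_poly of_rat f) y' = 0"
    and q: "coeffs_in \<rat> q" "poly q y = 0"
  shows "poly q y' = 0"
proof -
  interpret h: map_poly_comm_ring_hom "of_rat :: rat \<Rightarrow> 'a" by (rule of_rat_poly_hom)
  obtain q0 where q0: "q = map_poly of_rat q0" using coeffs_in_Rats[OF q(1)] .
  have "f dvd q0"
  proof (rule ccontr)
    assume "\<not> f dvd q0"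
    then obtain u v where "u * f + v * q0 = 1" using irreducible_bezout[OF f(1)] by blast
    then have "poly (map_poly of_rat (u * f + v * q0)) y = (1::'a)" by simp
    then show False using f(2) q(2) unfolding q0 by (simp add: h.hom_add h.hom_mult)
  qed
  then obtain s where "q0 = f * s" by blast
  then show ?thesis using f(3) unfolding q0 by (simp add: h.hom_mult)
qed

text \<open>In characteristic 0 the derivative of f is nonzero and of smaller degree, hence coprime
  to f, and a Bezout identity excludes a common root.\<close>

lemma irreducible_separable:
  fixes f :: "rat Polynomial.poly"
  assumes f: "Factorial_Ring.irreducible f"
  shows "rsquarefree (map_poly of_rat f :: 'a :: field_char_0 Polynomial.poly)"
proof -
  interpret h: map_poly_comm_ring_hom "of_rat :: rat \<Rightarrow> 'a" by (rule of_rat_poly_hom)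
  have "Polynomial.degree f > 0"
    using f by (metis gr0I irreducible_def is_unit_iff_degree)
  then have deg: "Polynomial.degree (pderiv f) < Polynomial.degree f" "pderiv f \<noteq> 0"
    by (auto simp: degree_pderiv pderiv_eq_0_iff)
  then have "\<not> f dvd pderiv f"
    using dvd_imp_degree_le by (metis not_le)
  then obtain u v where uv: "u * f + v * pderiv f = 1" using irreducible_bezout[OF f] by blast
  have pd: "map_poly of_rat (pderiv f) = pderiv (map_poly of_rat f :: 'a Polynomial.poly)"
    by (rule poly_eqI) (simp add: coeff_pderiv coeff_map_poly of_rat_mult of_rat_add)
  show ?thesis
    unfolding rsquarefree_roots
  proof (intro allI notI)
    fix a :: 'a
    assume a: "poly (map_poly of_rat f) a = 0 \<and> poly (pderiv (map_poly of_rat f)) a = 0"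
    have "poly (map_poly of_rat (u * f + v * pderiv f)) a = (1::'a)" using uv by simp
    then show False using a by (simp add: h.hom_add h.hom_mult pd)
  qed
qed

lemma rsquarefree_factorization:
  fixes g :: "'a :: {alg_closed_field, field_char_0} Polynomial.poly"
  assumes "rsquarefree g"
  shows "g = Polynomial.smult (Polynomial.lead_coeff g) (\<Prod>a | poly g a = 0. [:- a, 1:])"
proof -
  have g0: "g \<noteq> 0" using assms by (simp add: rsquarefree_def)
  obtain A where A: "g = Polynomial.smult (Polynomial.lead_coeff g) (\<Prod>x\<in>#A. [:- x, 1:])"
    using alg_closed_imp_factorization[OF g0] by blast
  have lc: "Polynomial.lead_coeff g \<noteq> 0" using g0 by simp
  have root: "poly g a = 0 \<longleftrightarrow> a \<in># A" for a
  proof -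
    have "poly (\<Prod>x\<in>#A. [:- x, 1:]) a = (\<Prod>x\<in>#A. a - x)"
      by (induction A) (auto simp: algebra_simps)
    also have "\<dots> = 0 \<longleftrightarrow> a \<in># A" by (auto simp: prod_mset_zero_iff)
    finally show ?thesis using lc by (subst A) simp
  qed
  \<comment> \<open>A repeated linear factor would make the derivative vanish at a too.\<close>
  have "count A a \<le> 1" for a
  proof (rule ccontr)
    assume "\<not> count A a \<le> 1"
    then have "{#a, a#} \<subseteq># A" by (simp add: subseteq_mset_def)
    then obtain B where B: "A = {#a, a#} + B" using mset_subset_eq_exists_conv by blast
    define h where "h = Polynomial.smult (Polynomial.lead_coeff g) (\<Prod>x\<in>#B. [:- x, 1:])"
    define r where "r = [:- a, 1:]"
    define k where "k = r * h"
    have r: "poly r a = 0" by (simp add: r_def)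
    then have k: "poly k a = 0" by (simp add: k_def)
    have "g = r * k"
      by (subst A) (simp add: B h_def k_def r_def mult_smult_right)
    then have "poly (pderiv g) a = 0" "poly g a = 0"
      using r k by (simp_all add: pderiv_mult)
    then show False using assms unfolding rsquarefree_roots by blast
  qed
  then have "A = mset_set (set_mset A)"
    by (intro multiset_eqI) (simp add: count_mset_set' le_less_Suc_eq not_in_iff, metis One_nat_def count_greater_eq_one_iff le_antisym)
  then have "(\<Prod>x\<in>#A. [:- x, 1:]) = (\<Prod>x\<in>set_mset A. [:- x, 1:])"
    by (metis prod_unfold_prod_mset)
  moreover have "set_mset A = {a. poly g a = 0}" using root by auto
  ultimately show ?thesis using A by simp
qed

text \<open>L is the splitting field of a polynomial g that vanishes on a rational basis of K. An
  embedding with y \<mapsto> y' sends roots of g to roots of g, so it maps L into itself; this is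
  normality.\<close>

lemma galois_closure_exists:
  fixes K :: "'a :: {alg_closed_field, field_char_0} set"
  assumes "number_field K"
  shows "\<exists>L. finite_galois L \<and> K \<subseteq> L"
proof -
  interpret K: number_field_loc K by unfold_locales fact
  interpret R: field "ambient :: 'a ring" by (rule field_from_type_algebra)
  obtain n where n: "R.dimension n \<rat> K"
    using assms by (auto simp: number_field_def has_degree_def)
  obtain Vs where Vs: "R.Span \<rat> Vs = K" "set Vs \<subseteq> carrier ambient"
    using R.exists_base[OF subfield_Rats n] by blast
  have VsK: "set Vs \<subseteq> K"
    using R.Span_base_incl[OF subfield_Rats Vs(2)] Vs(1) by simp
  have "\<forall>v\<in>set Vs. \<exists>q :: int Polynomial.poly. q \<noteq> 0 \<and> poly (map_poly of_int q) v = 0"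
    using VsK K.root_of_int_poly by (metis subsetD)
  then obtain qv :: "'a \<Rightarrow> int Polynomial.poly"
    where qv: "\<And>v. v \<in> set Vs \<Longrightarrow> qv v \<noteq> 0 \<and> poly (map_poly of_int (qv v)) v = 0"
    by metis
  define f where "f = (\<Prod>v\<in>set Vs. qv v)"
  have f0: "f \<noteq> 0" using qv by (auto simp: f_def)
  define g :: "'a Polynomial.poly" where "g = map_poly of_int f"
  have g0: "g \<noteq> 0"
    using f0 by (simp add: g_def map_poly_eq_0_iff)
  have gv: "poly g v = 0" if "v \<in> set Vs" for v
  proof -
    have "f = qv v * (\<Prod>v\<in>set Vs - {v}. qv v)"
      unfolding f_def using that by (intro prod.remove) auto
    then show ?thesis using qv[OF that] by (simp add: g_def of_int_poly_hom.hom_mult)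
  qed
  have gQ: "coeffs_in \<rat> g" by (simp add: coeffs_in_def g_def coeff_map_poly)
  obtain xs where xs: "set xs = {x. poly g x = 0}"
    using poly_roots_finite[OF g0] finite_list by blast
  have alg: "\<exists>q. coeffs_in \<rat> q \<and> q \<noteq> 0 \<and> poly q x = 0" if "x \<in> set xs" for x
    using that gQ g0 xs by blast
  have alg': "(R.algebraic over \<rat>) x" if "x \<in> set xs" for x
    using algebraic_over_ambient[OF subfield_Rats gQ g0] that xs by (simp add: over_def)
  define L where "L = R.finite_extension \<rat> xs"
  have sub_L: "subfield L ambient"
    unfolding L_def by (rule R.finite_extension_is_subfield[OF subfield_Rats]) (use alg' in auto)
  have fin_L: "R.finite_dimension \<rat> L"
    unfolding L_def by (rule R.finite_extension_finite_dimension(1)[OF subfield_Rats]) (use alg' in auto)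
  then have nf_L: "number_field L"
    using sub_L unfolding number_field_def has_degree_def by (auto elim: R.finite_dimensionE')
  have xsL: "set xs \<subseteq> L"
    unfolding L_def by (rule R.finite_extension_mem[OF subfieldE(1)[OF subfield_Rats]]) simp
  have "set Vs \<subseteq> L" using gv xs xsL by auto
  then have KL: "K \<subseteq> L"
    using R.subalgebra_Span_incl[OF subfield_Rats R.finite_dimension_imp_subalgebra[OF subfield_Rats fin_L], of Vs]
    by (simp only: Vs(1))
  have normal: "y' \<in> L"
    if f: "Factorial_Ring.irreducible f" "poly (map_poly of_rat f) y = 0" "poly (map_poly of_rat f) y' = 0"
      and y: "y \<in> L" for f :: "rat Polynomial.poly" and y y' :: 'a
  proof -
    have id: "partial_hom \<rat> (\<lambda>x::'a. x)" by (simp add: partial_hom_def subfield_Rats)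
    have fQ: "coeffs_in \<rat> (map_poly of_rat f :: 'a Polynomial.poly)" "(map_poly of_rat f :: 'a Polynomial.poly) \<noteq> 0"
      using f(1) by (auto simp: coeffs_in_def coeff_map_poly map_poly_eq_0_iff)
    define F where "F = R.simple_extension \<rat> y"
    obtain \<sigma> where s: "partial_hom F \<sigma>" "\<sigma> y = y'"
      using partial_hom_extend[OF id fQ f(2), of y'] irreducible_common_root[OF f] unfolding F_def
      by (auto simp: map_poly_id')
    \<comment> \<open>The embedding has to be defined on y and on all of L, so the roots of g are
      adjoined to the field generated by y.\<close>
    obtain \<tau> where t: "partial_hom (R.finite_extension F xs) \<tau>" "\<forall>x\<in>F. \<tau> x = \<sigma> x"
      using partial_hom_extend_finite[OF s(1) alg] by blast
    define E where "E = R.finite_extension F xs"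
    note H = partial_hom_props[OF t(1)[folded E_def]]
    have QF: "\<rat> \<subseteq> F" unfolding F_def by (rule R.simple_extension_incl) auto
    have LE: "L \<subseteq> E" unfolding L_def E_def by (rule R.mono_finite_extension[OF QF])
    have yF: "y \<in> F" unfolding F_def by (rule R.simple_extension_mem[OF subfieldE(1)[OF subfield_Rats]]) simp
    \<comment> \<open>The preimage of L. As L is generated by xs over \<rat>, it is enough that this
      is a subring containing both.\<close>
    define M where "M = {x \<in> E. \<tau> x \<in> L}"
    note cE = subfield_closed[OF H(1)]
    note cL = subfield_closed[OF sub_L]
    have "subring M ambient"
    proof (rule R.subringI)
      show "\<one>\<^bsub>ambient\<^esub> \<in> M" using cE(1) cL(1) H(2) by (simp add: M_def)
      show "\<ominus>\<^bsub>ambient\<^esub> x \<in> M" if "x \<in> M" for x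
        using that cE(5) cL(5) H(6) by (simp add: M_def)
      show "x \<otimes>\<^bsub>ambient\<^esub> z \<in> M" if "x \<in> M" "z \<in> M" for x z
        using that cE(4) cL(4) H(5) by (simp add: M_def)
      show "x \<oplus>\<^bsub>ambient\<^esub> z \<in> M" if "x \<in> M" "z \<in> M" for x z
        using that cE(3) cL(3) H(4) by (simp add: M_def)
    qed simp
    moreover have "\<rat> \<subseteq> M"
    proof
      fix x :: 'a assume "x \<in> \<rat>"
      then obtain r where "x = of_rat r" by (rule Rats_cases)
      then show "x \<in> M" using H(8) cE(12) cL(12) by (simp add: M_def)
    qed
    moreover have "set xs \<subseteq> M"
    proof
      fix x assume x: "x \<in> set xs"
      then have xE: "x \<in> E" using xsL LE by blast
      have "poly g (\<tau> x) = \<tau> (poly g x)"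
        unfolding g_def by (rule partial_hom_int_poly[OF t(1)[folded E_def] xE, symmetric])
      also have "\<dots> = 0" using x xs H(3) by simp
      finally have "\<tau> x \<in> set xs" using xs by simp
      then show "x \<in> M" using xE xsL by (auto simp: M_def)
    qed
    ultimately have "L \<subseteq> M" unfolding L_def by (rule R.finite_extension_subring_incl)
    then have "\<tau> y \<in> L" using y by (auto simp: M_def)
    then show ?thesis using t(2) yF s(2) by simp
  qed
  have "finite_galois L"
    unfolding finite_galois_def
  proof (intro conjI allI impI nf_L)
    fix f :: "rat Polynomial.poly"
    assume "Factorial_Ring.irreducible f \<and> (\<exists>x\<in>L. poly (map_poly of_rat f) x = 0)"
    then obtain y where f: "Factorial_Ring.irreducible f" "y \<in> L" "poly (map_poly of_rat f) y = 0"
      by blast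
    define S where "S = {a :: 'a. poly (map_poly of_rat f) a = 0}"
    have nz: "(map_poly of_rat f :: 'a Polynomial.poly) \<noteq> 0"
      using f(1) by (auto simp: map_poly_eq_0_iff)
    have "finite S" unfolding S_def by (rule poly_roots_finite[OF nz])
    moreover have "S \<subseteq> L"
    proof
      fix a assume "a \<in> S"
      then show "a \<in> L" unfolding S_def using normal[OF f(1,3) _ f(2)] by simp
    qed
    moreover have "Polynomial.lead_coeff (map_poly of_rat f :: 'a Polynomial.poly) = of_rat (Polynomial.lead_coeff f)"
      by (simp add: coeff_map_poly degree_map_poly)
    then have "map_poly of_rat f = Polynomial.smult (of_rat (Polynomial.lead_coeff f) :: 'a) (\<Prod>a\<in>S. [:- a, 1:])"
      using rsquarefree_factorization[OF irreducible_separable[OF f(1), where 'a = 'a]] unfolding S_def by simp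
    ultimately show "\<exists>S. finite S \<and> S \<subseteq> L \<and> map_poly of_rat f =
        Polynomial.smult (of_rat (Polynomial.lead_coeff f)) (\<Prod>a\<in>S. [:- a, 1:])"
      by blast
  qed
  then show ?thesis using KL by blast
qed

section \<open>Powers in the \<open>p\<close>-adic units\<close>

lemma cong_geometric_sum:
  fixes Z Y :: int
  assumes "[Z = Y] (mod M)"
  shows "[(\<Sum>i<n. Y ^ (n - Suc i) * Z ^ i) = int n * Y ^ (n - 1)] (mod M)"
proof -
  have "[(\<Sum>i<n. Y ^ (n - Suc i) * Z ^ i) = (\<Sum>i<n. Y ^ (n - 1))] (mod M)"
  proof (rule cong_sum)
    fix i assume "i \<in> {..<n}"
    then have "Y ^ (n - 1) = Y ^ (n - Suc i) * Y ^ i"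
      by (simp flip: power_add)
    then show "[Y ^ (n - Suc i) * Z ^ i = Y ^ (n - 1)] (mod M)"
      using cong_mult[OF cong_refl cong_pow[OF assms]] by metis
  qed
  then show ?thesis by simp
qed

text \<open>Each p-th power contributes a geometric sum congruent to p Y^(p - 1) modulo p^2, hence
  exactly one factor p. The congruence rests on s \<ge> 2; for p = 2 and s = 1 the exponent can
  jump, as with 3 - 1 = 2 and 9 - 1 = 8.\<close>

lemma lifting_the_exponent:
  fixes a b w :: int
  assumes p: "Factorial_Ring.prime p" and s: "s \<ge> 2" and ab: "a - b = int p ^ s * w" "\<not> int p dvd w"
    and b: "\<not> int p dvd b"
  shows "\<exists>w. a ^ (p ^ k) - b ^ (p ^ k) = int p ^ (s + k) * w \<and> \<not> int p dvd w"
proof (induction k)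
  case 0
  then show ?case using ab by auto
next
  case (Suc k)
  have ip: "Factorial_Ring.prime (int p)" using p by simp
  define Z Y where "Z = a ^ (p ^ k)" and "Y = b ^ (p ^ k)"
  obtain w where w: "Z - Y = int p ^ (s + k) * w" "\<not> int p dvd w"
    using Suc unfolding Z_def Y_def by blast
  have Y: "\<not> int p dvd Y ^ (p - 1)"
    using b prime_dvd_power[OF ip] unfolding Y_def by blast
  have "(int p)\<^sup>2 dvd int p ^ (s + k)" using s by (intro le_imp_power_dvd) auto
  then have "[Z = Y] (mod (int p)\<^sup>2)"
    using w(1) by (simp add: cong_iff_dvd_diff)
  then have "[(\<Sum>i<p. Y ^ (p - Suc i) * Z ^ i) = int p * Y ^ (p - 1)] (mod (int p)\<^sup>2)"
    by (rule cong_geometric_sum)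
  then obtain t where t: "(\<Sum>i<p. Y ^ (p - Suc i) * Z ^ i) = int p * Y ^ (p - 1) + (int p)\<^sup>2 * t"
    by (metis cong_iff_lin cong_sym)
  have "Z ^ p - Y ^ p = (Z - Y) * (\<Sum>i<p. Y ^ (p - Suc i) * Z ^ i)"
    by (rule power_diff_sumr2)
  also have "\<dots> = int p ^ (s + Suc k) * (w * (Y ^ (p - 1) + int p * t))"
    unfolding w(1) t by (simp add: algebra_simps power2_eq_square)
  finally have "a ^ (p ^ Suc k) - b ^ (p ^ Suc k) = int p ^ (s + Suc k) * (w * (Y ^ (p - 1) + int p * t))"
    unfolding Z_def Y_def by (simp add: power_mult[symmetric] mult.commute)
  moreover have "\<not> int p dvd w * (Y ^ (p - 1) + int p * t)"
    using w(2) Y prime_dvd_multD[OF ip] by (metis dvd_add_left_iff dvd_triv_left)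
  ultimately show ?case by blast
qed

text \<open>The closure of the powers of \<open>a / b\<close> in the \<open>p\<close>-adic units contains \<open>1 + p\<^sup>s\<int>\<^sub>p\<close>.\<close>

lemma power_quotient_approximates:
  fixes a b v w :: int
  assumes p: "Factorial_Ring.prime p" and s: "s \<ge> 2" and ab: "a - b = int p ^ s * w" "\<not> int p dvd w"
    and a: "\<not> int p dvd a" and b: "\<not> int p dvd b" and v: "int p ^ s dvd 1 - v"
  shows "\<exists>n. int p ^ (s + k) dvd a ^ n - b ^ n * v"
proof (induction k)
  case 0
  show ?case using v by (intro exI[of _ 0]) simp
next
  case (Suc k)
  have ip: "Factorial_Ring.prime (int p)" using p by simp
  then obtain n z where n: "a ^ n - b ^ n * v = int p ^ (s + k) * z"
    using Suc by blast
  define m where "m = p ^ k"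
  \<comment> \<open>Raising a / b to multiples of m = p^k disturbs the relation only from level p^(s
    + k) on, and there by a multiple of w, which is prime to p. One more digit can thus be
    corrected.\<close>
  define Z Y where "Z = a ^ m" and "Y = b ^ m"
  obtain w where w: "Z - Y = int p ^ (s + k) * w" "\<not> int p dvd w"
    using lifting_the_exponent[OF p s ab b, of k] unfolding Z_def Y_def m_def by blast
  have "\<not> int p dvd a ^ n * w"
    using prime_dvd_multD[OF ip] prime_dvd_power[OF ip] a w(2) by blast
  then have "coprime (a ^ n * w) (int p)"
    using ip by (metis coprime_commute prime_imp_coprime)
  then obtain u where u: "[a ^ n * w * u = 1] (mod int p)"
    using cong_solve_coprime_int by blast
  \<comment> \<open>Solves a^n w j + z Y = 0 modulo p. The extra summand p makes j positive, so that
    Y^j splits off a factor Y.\<close>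
  define j where "j = nat ((- z * Y * u) mod int p) + p"
  have "int j = (- z * Y * u) mod int p + int p"
    using prime_gt_0_nat[OF p] by (simp add: j_def)
  then have ju: "[int j = - z * Y * u] (mod int p)"
    by (simp add: cong_def)
  have j: "j > 0" using prime_gt_0_nat[OF p] by (simp add: j_def)
  define S where "S = (\<Sum>i<j. Y ^ (j - Suc i) * Z ^ i)"
  have "int p dvd int p ^ (s + k)" using s by (intro dvd_power) auto
  then have "[Z = Y] (mod int p)"
    using w(1) by (simp add: cong_iff_dvd_diff)
  then have S: "[S = int j * Y ^ (j - 1)] (mod int p)"
    unfolding S_def by (rule cong_geometric_sum)
  have "[a ^ n * w * int j = - z * Y] (mod int p)"
  proof -
    have "[a ^ n * w * int j = a ^ n * w * (- z * Y * u)] (mod int p)"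
      by (rule cong_mult[OF cong_refl ju])
    also have "a ^ n * w * (- z * Y * u) = (- z * Y) * (a ^ n * w * u)" by (simp add: algebra_simps)
    also have "[(- z * Y) * (a ^ n * w * u) = (- z * Y) * 1] (mod int p)"
      by (rule cong_mult[OF cong_refl u])
    finally show ?thesis by simp
  qed
  then have "int p dvd a ^ n * w * int j + z * Y"
    by (simp add: cong_iff_dvd_diff)
  then have "int p dvd (a ^ n * w * int j + z * Y) * Y ^ (j - 1)"
    by (rule dvd_mult2)
  moreover have "(a ^ n * w * int j + z * Y) * Y ^ (j - 1) = a ^ n * w * (int j * Y ^ (j - 1)) + z * Y ^ j"
    using j by (cases j) (simp_all add: algebra_simps)
  ultimately have 1: "int p dvd a ^ n * w * (int j * Y ^ (j - 1)) + z * Y ^ j"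
    by simp
  have "[a ^ n * w * S + z * Y ^ j = a ^ n * w * (int j * Y ^ (j - 1)) + z * Y ^ j] (mod int p)"
    by (intro cong_add cong_mult cong_refl S)
  then have "int p dvd a ^ n * w * S + z * Y ^ j"
    using 1 cong_dvd_iff by blast
  then have "int p ^ (s + Suc k) dvd int p ^ (s + k) * (a ^ n * w * S + z * Y ^ j)"
    by (simp add: mult.commute)
  also have "int p ^ (s + k) * (a ^ n * w * S + z * Y ^ j) = a ^ n * ((Z - Y) * S) + (a ^ n - b ^ n * v) * Y ^ j"
    unfolding w(1) n by (simp add: algebra_simps)
  also have "(Z - Y) * S = Z ^ j - Y ^ j"
    unfolding S_def by (rule power_diff_sumr2[symmetric])
  also have "a ^ n * (Z ^ j - Y ^ j) + (a ^ n - b ^ n * v) * Y ^ j = a ^ (n + m * j) - b ^ (n + m * j) * v"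
  proof -
    have "Z ^ j = a ^ (m * j)" "Y ^ j = b ^ (m * j)"
      by (simp_all add: Z_def Y_def power_mult)
    then show ?thesis by (simp add: algebra_simps power_add)
  qed
  finally show ?case by blast
qed

section \<open>The logarithmic derivative\<close>

text \<open>D x / x, kept as a rational number so that denominators of its values can be cleared in
  the final estimate.\<close>

definition log_deriv :: "'a :: field_char_0 set \<Rightarrow> 'a set set \<Rightarrow> 'a \<Rightarrow> rat"
  where "log_deriv L T x = (\<Sum>Q | Q \<in> T \<and> \<nu> L Q x \<noteq> 0.
    \<nu> L Q x / (of_nat (prime_below Q) * of_nat (primes_over_count (prime_below Q) L)))"

lemma subderivative_galois_eq: "subderivative_galois L T x = x * of_rat (log_deriv L T x)"
  by (simp add: subderivative_galois_def log_deriv_def)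

context number_field_loc
begin

lemma finite_val_support:
  assumes x: "x \<in> K" "x \<noteq> 0"
  shows "finite {Q \<in> nonzero_primes K. \<nu> K Q x \<noteq> 0}"
proof -
  obtain a b where ab: "a \<in> ints" "a \<noteq> 0" "b \<in> ints" "b \<noteq> 0" "x = a / b"
    by (rule quotient_of_integers[OF x])
  have "{Q \<in> nonzero_primes K. \<nu> K Q x \<noteq> 0} \<subseteq> {Q \<in> nonzero_primes K. a \<in> Q} \<union> {Q \<in> nonzero_primes K. b \<in> Q}"
  proof
    fix Q assume "Q \<in> {Q \<in> nonzero_primes K. \<nu> K Q x \<noteq> 0}"
    then have Q: "Q \<in> nonzero_primes K" "\<nu> K Q x \<noteq> 0" by auto
    interpret Q: prime_loc K Q by unfold_locales (rule Q(1))
    have "\<nu> K Q x = \<nu> K Q a - \<nu> K Q b"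
      using Q.val_divide[of a b] ab by simp
    then have "a \<in> Q \<or> b \<in> Q"
      using Q(2) Q.val_eq_0[OF ab(1,2)] Q.val_eq_0[OF ab(3,4)] by (cases "a \<in> Q"; cases "b \<in> Q") simp_all
    then show "Q \<in> {Q \<in> nonzero_primes K. a \<in> Q} \<union> {Q \<in> nonzero_primes K. b \<in> Q}"
      using Q(1) by simp
  qed
  then show ?thesis
    by (rule finite_subset) (intro finite_UnI finite_primes_containing ab)
qed

text \<open>Allows x, y and x * y to be summed over one common finite index set.\<close>

lemma log_deriv_eq_sum:
  assumes A: "finite A" "{Q \<in> T. \<nu> K Q x \<noteq> 0} \<subseteq> A" "A \<subseteq> T"
  shows "log_deriv K T x = (\<Sum>Q\<in>A. \<nu> K Q x / (of_nat (prime_below Q) * of_nat (primes_over_count (prime_below Q) K)))"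
  unfolding log_deriv_def
proof (rule sum.mono_neutral_left[OF A(1)])
  show "{Q. Q \<in> T \<and> \<nu> K Q x \<noteq> 0} \<subseteq> A" using A(2) .
  show "\<forall>Q\<in>A - {Q. Q \<in> T \<and> \<nu> K Q x \<noteq> 0}.
      \<nu> K Q x / (of_nat (prime_below Q) * of_nat (primes_over_count (prime_below Q) K)) = 0"
  proof
    fix Q assume "Q \<in> A - {Q. Q \<in> T \<and> \<nu> K Q x \<noteq> 0}"
    then have "\<nu> K Q x = 0" using A(3) by blast
    then show "\<nu> K Q x / (of_nat (prime_below Q) * of_nat (primes_over_count (prime_below Q) K)) = 0"
      by simp
  qed
qed

lemma log_deriv_mult:
  assumes T: "T \<subseteq> nonzero_primes K" and x: "x \<in> K" "x \<noteq> 0" and y: "y \<in> K" "y \<noteq> 0"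
  shows "log_deriv K T (x * y) = log_deriv K T x + log_deriv K T y"
proof -
  define A where "A = {Q \<in> T. \<nu> K Q x \<noteq> 0} \<union> {Q \<in> T. \<nu> K Q y \<noteq> 0}"
  have fin: "finite {Q \<in> T. \<nu> K Q z \<noteq> 0}" if "z \<in> K" "z \<noteq> 0" for z
    using finite_val_support[OF that] by (rule rev_finite_subset) (use T in blast)
  have "finite A"
    unfolding A_def by (rule finite_UnI[OF fin[OF x] fin[OF y]])
  have add: "\<nu> K Q (x * y) = \<nu> K Q x + \<nu> K Q y" if "Q \<in> T" for Q
  proof -
    interpret Q: prime_loc K Q by unfold_locales (use that T in blast)
    show ?thesis by (rule Q.val_mult[OF x y])
  qed
  have AT: "A \<subseteq> T" by (auto simp: A_def)
  have sub: "{Q \<in> T. \<nu> K Q x \<noteq> 0} \<subseteq> A" "{Q \<in> T. \<nu> K Q y \<noteq> 0} \<subseteq> A" "{Q \<in> T. \<nu> K Q (x * y) \<noteq> 0} \<subseteq> A"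
    using add by (auto simp: A_def)
  have add': "\<nu> K Q (x * y) = \<nu> K Q x + \<nu> K Q y" if "Q \<in> A" for Q using add that AT by blast
  show ?thesis
    unfolding log_deriv_eq_sum[OF \<open>finite A\<close> sub(1) AT] log_deriv_eq_sum[OF \<open>finite A\<close> sub(2) AT]
      log_deriv_eq_sum[OF \<open>finite A\<close> sub(3) AT] sum.distrib[symmetric]
    by (intro sum.cong refl) (simp add: add' add_divide_distrib)
qed

lemma log_deriv_power:
  assumes T: "T \<subseteq> nonzero_primes K" and x: "x \<in> K" "x \<noteq> 0"
  shows "log_deriv K T (x ^ k) = of_nat k * log_deriv K T x"
proof (induction k)
  case 0
  show ?case using log_deriv_mult[OF T K_closed(1) one_neq_zero K_closed(1) one_neq_zero] by simp
next
  case (Suc k)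
  then show ?case
    using log_deriv_mult[OF T x K_closed(9)[OF x(1)], of k] x(2) by (simp add: algebra_simps)
qed

lemma log_deriv_of_nat_nonneg:
  assumes T: "T \<subseteq> nonzero_primes K" and m: "m > 0"
  shows "log_deriv K T (of_nat m) \<ge> 0"
  unfolding log_deriv_def
proof (rule sum_nonneg)
  fix Q assume "Q \<in> {Q. Q \<in> T \<and> \<nu> K Q (of_nat m) \<noteq> 0}"
  then have "Q \<in> nonzero_primes K" using T by blast
  then interpret Q: prime_loc K Q by unfold_locales
  show "\<nu> K Q (of_nat m) / (of_nat (prime_below Q) * of_nat (primes_over_count (prime_below Q) K)) \<ge> 0"
    using Q.val_of_nat[OF m] by simp
qed

text \<open>At a positive integer no contribution is negative, so the positive summand at Q cannot
  be cancelled.\<close>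

lemma log_deriv_prime_pos:
  assumes T: "T \<subseteq> nonzero_primes K" and Q: "Q \<in> T" "lies_over Q q"
  shows "log_deriv K T (of_nat q) > 0"
proof -
  interpret Q: prime_loc K Q by unfold_locales (use Q T in blast)
  have q: "prime_below Q = q" by (rule Q.prime_below_eqI[OF Q(2)])
  have pq: "Factorial_Ring.prime q" using Q.prime_p0 q by simp
  have "{Q \<in> nonzero_primes K. lies_over Q q} \<noteq> {}" using Q T by blast
  then have count: "primes_over_count q K > 0"
    unfolding primes_over_count_def using finite_primes_over[OF pq] by (simp add: card_gt_0_iff)
  have v: "\<nu> K Q (of_nat q) = 1" using Q.val_p0 q by simp
  have nz: "of_nat q \<noteq> (0::'a)" using prime_gt_0_nat[OF pq] by simp
  show ?thesis
    unfolding log_deriv_def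
  proof (rule sum_pos2[of _ Q])
    show "finite {Q. Q \<in> T \<and> \<nu> K Q (of_nat q) \<noteq> 0}"
      using finite_val_support[OF K_closed(10) nz] by (rule rev_finite_subset) (use T in blast)
    show "Q \<in> {Q. Q \<in> T \<and> \<nu> K Q (of_nat q) \<noteq> 0}" using Q(1) v by simp
    show "0 < \<nu> K Q (of_nat q) / (of_nat (prime_below Q) * of_nat (primes_over_count (prime_below Q) K))"
      unfolding q v using count prime_gt_0_nat[OF pq] by simp
    fix Q' assume "Q' \<in> {Q. Q \<in> T \<and> \<nu> K Q (of_nat q) \<noteq> 0}"
    then have "Q' \<in> nonzero_primes K" using T by blast
    then interpret Q': prime_loc K Q' by unfold_locales
    show "0 \<le> \<nu> K Q' (of_nat q) / (of_nat (prime_below Q') * of_nat (primes_over_count (prime_below Q') K))"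
      using Q'.val_of_nat[OF prime_gt_0_nat[OF pq]] by simp
  qed
qed

end

section \<open>Discontinuity\<close>

lemma lies_over_prime_above:
  assumes K: "number_field K" and Q: "Q \<inter> carrier (\<O> K) = Q0" and q: "lies_over Q0 q"
  shows "lies_over Q q"
proof -
  interpret K: number_field_loc K by unfold_locales (rule K)
  have "of_int m \<in> Q \<longleftrightarrow> of_int m \<in> Q0" for m
    using K.ints_closed(9)[of m] Q by auto
  then show ?thesis using q unfolding lies_over_def by simp
qed

lemma nonneg_rat_quotient:
  assumes "(r::rat) \<ge> 0"
  obtains m n :: nat where "n > 0" "r = of_nat m / of_nat n"
proof (cases r)
  case (Fract a b)
  then have "a \<ge> 0" using assms by (simp add: Rat.zero_le_Fract_iff)
  then have "r = of_nat (nat a) / of_nat (nat b)"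
    using Fract by (simp add: Rat.Fract_of_int_quotient)
  then show ?thesis using that[of "nat b" "nat a"] Fract by simp
qed

text \<open>Here u = e / d. The order of choices matters: a, b, s and v are fixed before N, so B =
  \<open>ld v\<close> is independent of N and only the exponent n of the correction varies.\<close>

lemma (in number_field_loc) log_deriv_const_near_1:
  assumes T: "T \<subseteq> nonzero_primes K" and p: "Factorial_Ring.prime p"
    and Q: "Q \<in> T" "lies_over Q q" "q \<noteq> p"
  obtains B :: rat where "B > 0"
    "\<And>N. \<exists>(d::nat) (e::nat) z. d > 0 \<and> e > 0 \<and> \<not> p dvd d \<and> \<not> p dvd e \<and>
      int e - int d = int p ^ N * z \<and> log_deriv K T (of_nat e) = log_deriv K T (of_nat d) + B"
proof -
  define ld where "ld = (\<lambda>m::nat. log_deriv K T (of_nat m))"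
  have q: "Factorial_Ring.prime q" using Q(2) by (simp add: lies_over_def)
  have ld_mult: "ld (m * n) = ld m + ld n" if "m > 0" "n > 0" for m n
    using log_deriv_mult[OF T K_closed(10) _ K_closed(10), of m n] that by (simp add: ld_def)
  have ld_power: "ld (m ^ k) = of_nat k * ld m" if "m > 0" for m k
    using log_deriv_power[OF T K_closed(10), of m k] that by (simp add: ld_def)
  obtain q1 where q1: "Factorial_Ring.prime q1" "p + q < q1"
    using bigger_prime by blast
  have A0: "ld q > 0" unfolding ld_def by (rule log_deriv_prime_pos[OF T Q(1,2)])
  have A1: "ld q1 \<ge> 0" unfolding ld_def by (rule log_deriv_of_nat_nonneg[OF T prime_gt_0_nat[OF q1(1)]])
  \<comment> \<open>Rationality of this ratio gives exponents that balance q1 against q. If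
    \<open>ld q1\<close> is 0, then n1 = 0 and b = 1.\<close>
  have "ld q1 / ld q \<ge> 0" using A0 A1 by simp
  then obtain n1 n0 :: nat where n: "n0 > 0" "ld q1 / ld q = of_nat n1 / of_nat n0"
    by (rule nonneg_rat_quotient)
  then have rel: "of_nat n0 * ld q1 = of_nat n1 * ld q"
    using A0 by (simp add: field_simps)
  \<comment> \<open>By Euler both E-th powers are 1 modulo p^2; this secures the bound s \<ge> 2
    demanded by lifting the exponent.\<close>
  define E where "E = totient (p\<^sup>2)"
  have E: "E > 0" using prime_gt_0_nat[OF p] by (simp add: E_def)
  define a b where "a = (q1 ^ n0) ^ E" and "b = (q ^ n1) ^ E"
  have cop: "coprime q1 p" "coprime q p"
    using primes_coprime[OF q1(1) p] primes_coprime[OF q p] q1(2) Q(3) by auto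
  have pos: "q1 > 0" "q > 0" "a > 0" "b > 0"
    using prime_gt_0_nat[OF q1(1)] prime_gt_0_nat[OF q] by (auto simp: a_def b_def)
  have ld_ab: "ld a = ld b"
    using pos rel by (simp add: a_def b_def ld_power)
  have "q1 ^ n0 \<noteq> q ^ n1"
  proof
    assume "q1 ^ n0 = q ^ n1"
    then have "q1 dvd q ^ n1" using n(1) by (metis dvd_power)
    then have "q1 dvd q" using prime_dvd_power[OF q1(1)] by blast
    then show False using q1(2) dvd_imp_le[OF _ pos(2)] by fastforce
  qed
  then have "a \<noteq> b"
    using E by (simp add: a_def b_def power_eq_iff_eq_base)
  have "[a = 1] (mod p\<^sup>2)" "[b = 1] (mod p\<^sup>2)"
    unfolding a_def b_def E_def by (rule euler_theorem; use cop in simp)+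
  then have "[a = b] (mod p\<^sup>2)"
    by (metis cong_trans cong_sym)
  then have "[int a = int b] (mod (int p)\<^sup>2)"
    by (metis cong_int_iff of_nat_power)
  then have p2: "(int p)\<^sup>2 dvd int a - int b"
    by (simp add: cong_iff_dvd_diff)
  define s where "s = multiplicity (int p) (int a - int b)"
  have nu: "\<not> is_unit (int p)" using prime_gt_1_nat[OF p] by auto
  have ab0: "int a - int b \<noteq> 0" using \<open>a \<noteq> b\<close> by simp
  have s: "s \<ge> 2" unfolding s_def by (rule multiplicity_geI[OF ab0 nu p2])
  obtain w where w: "int a - int b = int p ^ s * w" "\<not> int p dvd w"
    using multiplicity_decompose'[OF ab0 nu] unfolding s_def by blast
  \<comment> \<open>Congruent to 1 modulo p^s, hence within reach of the powers of a / b, and with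
    logarithmic derivative a positive multiple of \<open>ld q\<close>.\<close>
  define v where "v = q ^ totient (p ^ s)"
  have "[v = 1] (mod p ^ s)"
    unfolding v_def using cop by (intro euler_theorem) auto
  then have "[int v = 1] (mod int p ^ s)"
    by (metis cong_int_iff of_nat_1 of_nat_power)
  then have v: "int p ^ s dvd 1 - int v"
    by (metis cong_iff_dvd_diff cong_sym)
  have ndvd: "\<not> p dvd a" "\<not> p dvd b" "\<not> p dvd v"
    using cop p prime_dvd_power[OF p] unfolding a_def b_def v_def
    by (metis coprime_commute coprime_absorb_left not_prime_unit power_one)+
  define B where "B = ld v"
  have B: "B > 0"
    using A0 pos(2) prime_gt_0_nat[OF p] by (simp add: B_def v_def ld_power)
  have v0: "v > 0" using pos(2) by (simp add: v_def)
  have "\<exists>(d::nat) (e::nat) z. d > 0 \<and> e > 0 \<and> \<not> p dvd d \<and> \<not> p dvd e \<and>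
      int e - int d = int p ^ N * z \<and> log_deriv K T (of_nat e) = log_deriv K T (of_nat d) + B" for N
  proof -
    obtain n where n: "int p ^ (s + N) dvd int a ^ n - int b ^ n * int v"
      using power_quotient_approximates[OF p s w _ _ v] ndvd by (metis int_dvd_int_iff)
    \<comment> \<open>As \<open>ld a = ld b\<close>, the n-th powers cancel in
      \<open>ld e - ld d\<close> and leave \<open>ld v\<close>.\<close>
    define d e where "d = a ^ n" and "e = b ^ n * v"
    have "int p ^ N dvd int p ^ (s + N)" by (rule le_imp_power_dvd) simp
    then have "int p ^ N dvd int e - int d"
      using n by (metis d_def e_def dvd_minus_iff dvd_trans minus_diff_eq of_nat_mult of_nat_power)
    then obtain z where z: "int e - int d = int p ^ N * z" by blast
    have "\<not> p dvd d" "\<not> p dvd e"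
      using ndvd prime_dvd_power[OF p] prime_dvd_multD[OF p] unfolding d_def e_def by blast+
    moreover have "d > 0" "e > 0" using pos v0 by (auto simp: d_def e_def)
    moreover have "ld e = ld d + B"
      using pos v0 by (simp add: d_def e_def ld_mult ld_power ld_ab B_def)
    ultimately show ?thesis using z unfolding ld_def by blast
  qed
  then show ?thesis using that[OF B] by blast
qed

theorem theorem5p9:
  fixes K P :: "'a :: {alg_closed_field, field_char_0} set"
    and T :: "'a set set"
    and n p :: nat
    and c :: real
  assumes "number_field K" and "has_degree K n"
    and "P \<in> nonzero_primes K" and "lies_over P p"
    and "T \<subseteq> nonzero_primes K" and "T \<noteq> {}" and "T \<noteq> {P}"
    and "\<exists>Q\<in>T. \<not> lies_over Q p"
    and "0 < c" and "c < 1"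
  shows "\<forall>x\<in>K - {0}. \<not> padic_continuous_at c K P (subderivative K T) x"
proof (intro ballI notI)
  fix x assume xK: "x \<in> K - {0}" and cont: "padic_continuous_at c K P (subderivative K T) x"
  then have x: "x \<in> K" "x \<noteq> 0" by auto
  interpret P: prime_loc K P by unfold_locales (use assms in auto)
  have p0: "prime_below P = p" by (rule P.prime_below_eqI[OF assms(4)])
  have p: "Factorial_Ring.prime p" using P.prime_p0 p0 by simp
  \<comment> \<open>The very field selected inside \<open>subderivative\<close>, so that the
    definition can be unfolded.\<close>
  define L where "L = (SOME L. finite_galois L \<and> K \<subseteq> L)"
  have "finite_galois L \<and> K \<subseteq> L"
    unfolding L_def by (rule someI_ex) (rule galois_closure_exists[OF assms(1)])
  then have L: "number_field L" "K \<subseteq> L" by (auto simp: finite_galois_def)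
  interpret L: number_field_loc L by unfold_locales (rule L(1))
  define TL where "TL = primes_above L K T"
  have TL: "TL \<subseteq> nonzero_primes L" by (auto simp: TL_def primes_above_def)
  define ld where "ld = log_deriv L TL"
  have D: "subderivative K T y = y * of_rat (ld y)" for y
    by (simp add: subderivative_def Let_def L_def[symmetric] TL_def[symmetric] subderivative_galois_eq ld_def)
  obtain Q0 where Q0: "Q0 \<in> T" "\<not> lies_over Q0 p" using assms(8) by blast
  interpret Q0: prime_loc K Q0 by unfold_locales (use Q0 assms in blast)
  obtain Q where Q: "Q \<in> nonzero_primes L" "Q \<inter> carrier (\<O> K) = Q0"
    by (rule Q0.lying_over[OF L])
  define q where "q = prime_below Q0"
  have q: "lies_over Q0 q" unfolding q_def by (rule Q0.lies_over_prime_below)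
  then have "q \<noteq> p" using Q0(2) by blast
  have "lies_over Q q" by (rule lies_over_prime_above[OF assms(1) Q(2) q])
  moreover have "Q \<in> TL" using Q Q0(1) by (simp add: TL_def primes_above_def)
  ultimately obtain B :: rat where B: "B > 0"
    and near: "\<And>N. \<exists>(d::nat) (e::nat) z. d > 0 \<and> e > 0 \<and> \<not> p dvd d \<and> \<not> p dvd e \<and>
      int e - int d = int p ^ N * z \<and> ld (of_nat e) = ld (of_nat d) + B"
    using L.log_deriv_const_near_1[OF TL p _ _ \<open>q \<noteq> p\<close>] unfolding ld_def by blast
  \<comment> \<open>This will be \<open>ld y\<close> for every approximating y. Writing B and C over
    one denominator \<delta> reduces the estimate to divisibility of integers.\<close>
  define C where "C = ld x + B"
  obtain \<delta> where \<delta>: "\<delta> > 0" "of_int \<delta> * B \<in> \<int>" "of_int \<delta> * C \<in> \<int>"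
  proof -
    have "r \<in> \<rat>" for r :: rat by (cases r) (simp add: Rat.Fract_of_int_quotient)
    then show ?thesis using Rats_common_denominator[of "{B, C}" "\<lambda>r. r"] that by auto
  qed
  obtain \<beta> \<kappa> where "of_int \<delta> * B = of_int \<beta>" "of_int \<delta> * C = of_int \<kappa>"
    using \<delta>(2,3) by (elim Ints_cases)
  then have BC: "B = of_int \<beta> / of_int \<delta>" "C = of_int \<kappa> / of_int \<delta>"
    using \<delta>(1) by (simp_all add: field_simps)
  have \<beta>: "\<beta> \<noteq> 0" using B BC by auto
  define k where "k = multiplicity (int p) \<beta>"
  \<comment> \<open>The absolute value of x B, since B = \<beta> / \<delta> and k is the
    multiplicity of p in \<beta>. As c < 1, a valuation of at most this exponent means an absolute
    value of at least \<epsilon>.\<close>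
  define \<epsilon> where "\<epsilon> = c powr of_rat (\<nu> K P x + of_nat k - \<nu> K P (of_int \<delta>))"
  have "\<epsilon> > 0" using assms(9) by (simp add: \<epsilon>_def)
  then obtain \<eta> where \<eta>: "\<eta> > 0"
    "\<And>y. y \<in> K \<Longrightarrow> padic_abs c K P (y - x) < \<eta> \<Longrightarrow> padic_abs c K P (subderivative K T y - subderivative K T x) < \<epsilon>"
    using cont unfolding padic_continuous_at_def by blast
  define r where "r = c powr of_rat (\<nu> K P x)"
  have r: "r > 0" using assms(9) by (simp add: r_def)
  obtain N0 where N0: "c ^ N0 < \<eta> / r"
    using real_arch_pow_inv[of "\<eta> / r" c] \<eta>(1) r assms(10) by auto
  \<comment> \<open>\<open>N0\<close> brings y within \<eta> of x; \<open>Suc k\<close> makes the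
    perturbation divisible by a higher power of p than divides \<beta>.\<close>
  define N where "N = max N0 (Suc k)"
  have "c ^ N \<le> c ^ N0" using assms(9,10) by (intro power_decreasing) (auto simp: N_def)
  then have "r * c ^ N \<le> r * c ^ N0" using r by simp
  also have "\<dots> < \<eta>" using N0 r by (simp add: field_simps)
  finally have "r * c ^ N < \<eta>" .
  then have cN: "c powr of_rat (\<nu> K P x + of_nat N) < \<eta>"
    using assms(9) by (simp add: r_def of_rat_add powr_add powr_realpow)
  obtain d e :: nat and z where de: "d > 0" "e > 0" "\<not> p dvd d" "\<not> p dvd e"
    "int e - int d = int p ^ N * z" "ld (of_nat e) = ld (of_nat d) + B"
    using near by blast
  have nz: "of_nat d \<noteq> (0::'a)" "of_nat e \<noteq> (0::'a)" "of_int \<delta> \<noteq> (0::'a)"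
    using de \<delta>(1) by auto
  define y where "y = x * of_nat e / of_nat d"
  have y: "y \<in> K" "y \<noteq> 0"
    unfolding y_def using x nz by (auto intro!: P.K_closed(8) P.K_closed(4) P.K_closed(10))
  have "y * of_nat d = x * of_nat e" using nz by (simp add: y_def)
  then have "ld y + ld (of_nat d) = ld x + ld (of_nat e)"
    unfolding ld_def using x y nz L(2)
    by (subst (1 2) L.log_deriv_mult[OF TL, symmetric]) (auto intro: L.K_closed(10))
  then have ldy: "ld y = C" using de(6) by (simp add: C_def)
  have ed: "of_nat e = (of_nat d + of_nat p ^ N * of_int z :: 'a)"
  proof -
    have "int e = int d + int p ^ N * z" using de(5) by simp
    then have "(of_int (int e) :: 'a) = of_int (int d + int p ^ N * z)" by simp
    then show ?thesis by simp
  qed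
  have vd: "\<nu> K P (of_nat d) = 0"
    using de(3) by (intro P.val_eq_0 P.ints_closed(8) nz) (simp add: P.of_nat_in_P_iff p0)
  have "padic_abs c K P (y - x) < \<eta>"
  \<comment> \<open>The absolute value of 0 is set separately from the valuation, so y = x is
    treated apart.\<close>
  proof (cases "z = 0")
    case True
    then have "y = x" using ed nz by (simp add: y_def)
    then show ?thesis using \<eta>(1) by (simp add: padic_abs_def)
  next
    case False
    define w where "w = int p ^ N * z"
    have w0: "w \<noteq> 0" using False prime_gt_0_nat[OF p] by (simp add: w_def)
    have eq: "y - x = x * of_int w / of_nat d"
      using nz by (simp add: y_def ed w_def field_simps)
    have "N \<le> multiplicity (int p) w"
      using w0 prime_gt_1_nat[OF p] by (intro multiplicity_geI) (auto simp: w_def)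
    moreover have "\<nu> K P (y - x) = \<nu> K P x + of_nat (multiplicity (int p) w)"
      unfolding eq using x nz w0 vd P.val_of_int[OF w0] p0
      by (subst P.val_divide) (auto simp: P.val_mult P.K_closed(11,10) intro!: P.K_closed(4))
    ultimately have "\<nu> K P x + of_nat N \<le> \<nu> K P (y - x)" by simp
    then have "(of_rat (\<nu> K P x + of_nat N) :: real) \<le> of_rat (\<nu> K P (y - x))"
      by (simp only: of_rat_less_eq)
    then have "c powr of_rat (\<nu> K P (y - x)) \<le> c powr of_rat (\<nu> K P x + of_nat N)"
      using assms(9,10) by (intro powr_mono') auto
    moreover have "y - x \<noteq> 0" using eq x nz w0 by simp
    ultimately show ?thesis using cN by (simp add: padic_abs_def)
  qed
  then have small: "padic_abs c K P (subderivative K T y - subderivative K T x) < \<epsilon>"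
    using \<eta>(2) y(1) by blast
  \<comment> \<open>With y = x e / d and e = d + p^N z, the difference y C - x (C - B) equals x M /
    (\<delta> d). Modulo p^(k + 1) only \<beta> d survives in M, and d is prime to p.\<close>
  define M where "M = \<beta> * int d + int p ^ N * z * \<kappa>"
  have pk: "\<not> int p ^ Suc k dvd M"
  proof
    assume "int p ^ Suc k dvd M"
    moreover have "int p ^ Suc k dvd int p ^ N"
      by (intro le_imp_power_dvd) (simp add: N_def)
    then have "int p ^ Suc k dvd int p ^ N * z * \<kappa>" by (intro dvd_mult2)
    ultimately have "int p ^ Suc k dvd \<beta> * int d" unfolding M_def by (metis dvd_add_left_iff)
    moreover have "coprime (int p ^ Suc k) (int d)"
      using de(3) p by (simp add: prime_imp_coprime del: power_Suc)
    ultimately have "int p ^ Suc k dvd \<beta>" by (metis coprime_dvd_mult_left_iff)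
    then have "Suc k \<le> multiplicity (int p) \<beta>"
      using \<beta> prime_gt_1_nat[OF p] by (intro multiplicity_geI) auto
    then show False by (simp add: k_def)
  qed
  then have M0: "M \<noteq> 0" by auto
  have "multiplicity (int p) M < Suc k"
    by (rule multiplicity_lessI) (use M0 pk prime_gt_1_nat[OF p] in auto)
  have "subderivative K T y - subderivative K T x = y * of_rat C - x * of_rat (C - B)"
    unfolding D ldy by (simp add: C_def)
  also have "\<dots> = x * of_int M / (of_int \<delta> * of_nat d)"
    using nz unfolding BC y_def ed M_def
    by (simp add: of_rat_diff of_rat_divide divide_simps) (simp add: algebra_simps)
  finally have eq: "subderivative K T y - subderivative K T x = x * of_int M / (of_int \<delta> * of_nat d)" .
  have "\<nu> K P (x * of_int M / (of_int \<delta> * of_nat d)) = \<nu> K P x + of_nat (multiplicity (int p) M) - \<nu> K P (of_int \<delta>)"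
    using x nz M0 vd P.val_of_int[OF M0] p0
    by (subst P.val_divide) (auto simp: P.val_mult P.K_closed(11,10) intro!: P.K_closed(4))
  also have "\<dots> \<le> \<nu> K P x + of_nat k - \<nu> K P (of_int \<delta>)"
    using \<open>multiplicity (int p) M < Suc k\<close> by simp
  finally have "(of_rat (\<nu> K P (x * of_int M / (of_int \<delta> * of_nat d))) :: real) \<le> of_rat (\<nu> K P x + of_nat k - \<nu> K P (of_int \<delta>))"
    by (simp only: of_rat_less_eq)
  then have "\<epsilon> \<le> c powr of_rat (\<nu> K P (x * of_int M / (of_int \<delta> * of_nat d)))"
    unfolding \<epsilon>_def using assms(9,10) by (intro powr_mono') auto
  moreover have "x * of_int M / (of_int \<delta> * of_nat d) \<noteq> 0" using x nz M0 by simp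
  ultimately have "\<epsilon> \<le> padic_abs c K P (subderivative K T y - subderivative K T x)"
    unfolding eq padic_abs_def by simp
  then show False using small by simp
qed

end
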